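(* Assume the Continuum Hypothesis ($\mathsf{CH}$). Then $\mathcal{H}(\omega^* )_{(\delta)}$ is universal for the class of all $P$-groups of weight at most ${\mathfrak c}$; that is, $\mathcal{H}(\omega^* )_{(\delta)}$ is itself a $P$-group of weight at most ${\mathfrak c}$, and every $P$-group of weight at most ${\mathfrak c}$ is topologically isomorphic to a subgroup (with the subspace topology) of $\mathcal{H}(\omega^* )_{(\delta)}$.
   Context: All topological spaces (including those underlying topological groups) are assumed to be Tychonoff. ${\mathfrak c}=2^{\aleph_0}$. The weight of a space is the least cardinality of a base. $\beta\omega$ is the Čech–Stone compactification of the discrete space $\omega$, and $\omega^*=\beta\omega\setminus\omega$. A $P$-space is a space in which every $G_\delta$-subset is open. A $P$-group is a topological group whose underlying space is a $P$-space. For a topological group $G$, its $G_\delta$-modification $G_{(\delta)}$ is the group $G$ with the topology having the $G_\delta$-subsets of $G$ as a base; it is again a topological group. For a compact space $X$, $\mathcal{H}(X)$ is the group of all homeomorphisms $X\to X$ under composition, endowed with the compact-open topology, i.e. the topology with subbase all sets $[K,U]=\{f\in\mathcal{H}(X): f(K)\subseteq U\}$, $K\subseteq X$ compact, $U\subseteq X$ open; it is a topological group. A topological isomorphism is a group isomorphism that is also a homeomorphism. If $\mathcal{K}$ is a class of topological groups, $G\in\mathcal{K}$ is universal for $\mathcal{K}$ if every member of $\mathcal{K}$ is topologically isomorphic to a subgroup of $G$. *)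

theory Defs
  imports "HOL-Analysis.Analysis" "HOL-Algebra.Bij"
begin

unbundle cardinal_syntax

abbreviation continuum :: "(nat \<Rightarrow> bool) rel" where
  "continuum \<equiv> ctwo ^c natLeq"

definition CH :: bool where
  "CH \<longleftrightarrow> cardSuc natLeq =o continuum"

definition base_of :: "'a topology \<Rightarrow> 'a set set \<Rightarrow> bool" where
  "base_of X \<B> \<longleftrightarrow> (\<forall>V\<in>\<B>. openin X V) \<and>
     (\<forall>U x. openin X U \<and> x \<in> U \<longrightarrow> (\<exists>V\<in>\<B>. x \<in> V \<and> V \<subseteq> U))"

definition weight :: "'a topology \<Rightarrow> 'a set rel" where
  "weight X = |SOME \<B>. base_of X \<B> \<and> (\<forall>\<C>. base_of X \<C> \<longrightarrow> |\<B>| \<le>o |\<C>| )|"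

lemma weight_minimal_base:
  shows "\<exists>\<B>. base_of X \<B> \<and> weight X = |\<B>|"
    and "base_of X \<C> \<Longrightarrow> weight X \<le>o |\<C>|"
proof -
  let ?R = "card_of ` {\<B>. base_of X \<B>}"
  have "base_of X {U. openin X U}"
    by (auto simp: base_of_def)
  then have "?R \<noteq> {}"
    by blast
  moreover have "\<forall>r\<in>?R. Card_order r"
    by (auto simp: card_of_Card_order)
  ultimately obtain r where "r \<in> ?R" "\<forall>r'\<in>?R. r \<le>o r'"
    using exists_minim_Card_order by meson
  then have "\<exists>\<B>. base_of X \<B> \<and> (\<forall>\<C>. base_of X \<C> \<longrightarrow> |\<B>| \<le>o |\<C>| )"
    by auto
  from someI_ex[OF this] show "\<exists>\<B>. base_of X \<B> \<and> weight X = |\<B>|"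
    and "base_of X \<C> \<Longrightarrow> weight X \<le>o |\<C>|"
    unfolding weight_def by blast+
qed

definition tychonoff_space :: "'a topology \<Rightarrow> bool" where
  "tychonoff_space X \<longleftrightarrow> t1_space X \<and> completely_regular_space X"

definition P_space :: "'a topology \<Rightarrow> bool" where
  "P_space X \<longleftrightarrow> (\<forall>S. gdelta_in X S \<longrightarrow> openin X S)"

text \<open>All spaces, in particular those underlying topological groups, are Tychonoff by convention.\<close>

definition topological_group :: "('a, 'b) monoid_scheme \<Rightarrow> 'a topology \<Rightarrow> bool" where
  "topological_group G X \<longleftrightarrow>
     group G \<and> topspace X = carrier G \<and> tychonoff_space X \<and>
     continuous_map (prod_topology X X) X (\<lambda>(x, y). x \<otimes>\<^bsub>G\<^esub> y) \<and>
     continuous_map X X (\<lambda>x. inv\<^bsub>G\<^esub> x)"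

definition P_group :: "('a, 'b) monoid_scheme \<Rightarrow> 'a topology \<Rightarrow> bool" where
  "P_group G X \<longleftrightarrow> topological_group G X \<and> P_space X"

definition topological_isomorphism ::
    "('a, 'c) monoid_scheme \<Rightarrow> 'a topology \<Rightarrow> ('b, 'd) monoid_scheme \<Rightarrow> 'b topology \<Rightarrow> ('a \<Rightarrow> 'b) \<Rightarrow> bool"
  where
  "topological_isomorphism G X H Y h \<longleftrightarrow> h \<in> iso G H \<and> homeomorphic_map X Y h"

definition isomorphic_to_subgroup ::
    "('a, 'c) monoid_scheme \<Rightarrow> 'a topology \<Rightarrow> ('b, 'd) monoid_scheme \<Rightarrow> 'b topology \<Rightarrow> bool"
  where
  "isomorphic_to_subgroup G X H Y \<longleftrightarrow>
     (\<exists>K h. subgroup K H \<and>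
        topological_isomorphism G X (H\<lparr>carrier := K\<rparr>) (subtopology Y K) h)"

definition Gdelta_modification :: "'a topology \<Rightarrow> 'a topology" where
  "Gdelta_modification X = topology (arbitrary union_of gdelta_in X)"

lemma openin_Gdelta_modification:
  "openin (Gdelta_modification X) = arbitrary union_of gdelta_in X"
  unfolding Gdelta_modification_def
  by (intro topology_inverse' istopology_base gdelta_in_Int)

text \<open>As in \<^const>\<open>BijGroup\<close>, homeomorphisms are represented by functions that are extensional
  on the space, so that each homeomorphism has exactly one representative.\<close>

definition homeo_group :: "'a topology \<Rightarrow> ('a \<Rightarrow> 'a) monoid" where
  "homeo_group X =
     BijGroup (topspace X) \<lparr>carrier := {f \<in> Bij (topspace X). homeomorphic_map X X f}\<rparr>"

definition compact_open_topology :: "'a topology \<Rightarrow> ('a \<Rightarrow> 'a) topology" where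
  "compact_open_topology X = topology_generated_by
     {{f \<in> carrier (homeo_group X). f ` K \<subseteq> U} | K U. compactin X K \<and> openin X U}"

text \<open>The Cech-Stone compactification of a Tychonoff space \<open>X\<close> is the closure of the image of \<open>X\<close> under the
  evaluation map into the cube whose coordinates are all continuous functions from \<open>X\<close> to the unit
  interval. These functions are taken extensional on \<open>X\<close>, so that none occurs twice.\<close>

definition unit_functions :: "'a topology \<Rightarrow> ('a \<Rightarrow> real) set" where
  "unit_functions X =
     {f \<in> extensional (topspace X). continuous_map X (top_of_set {0..1}) f}"

definition evaluation :: "'a topology \<Rightarrow> 'a \<Rightarrow> ('a \<Rightarrow> real) \<Rightarrow> real" where
  "evaluation X x = (\<lambda>f\<in>unit_functions X. f x)"

definition cech_stone :: "'a topology \<Rightarrow> (('a \<Rightarrow> real) \<Rightarrow> real) topology" where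
  "cech_stone X =
     (let Q = product_topology (\<lambda>f. top_of_set {0..1}) (unit_functions X)
      in subtopology Q (Q closure_of (evaluation X ` topspace X)))"

definition cech_stone_remainder :: "'a topology \<Rightarrow> (('a \<Rightarrow> real) \<Rightarrow> real) topology" where
  "cech_stone_remainder X =
     subtopology (cech_stone X) (topspace (cech_stone X) - evaluation X ` topspace X)"

abbreviation omega_star :: "((nat \<Rightarrow> real) \<Rightarrow> real) topology" where
  "omega_star \<equiv> cech_stone_remainder (discrete_topology (UNIV :: nat set))"

end

(* A P-group has a base of open subgroups at the identity, so a P-group of weight at most c acts
   faithfully by permutations on a set of at most c cosets, and its topology is the one induced by the
   pointwise stabilizers of the countable (equivalently, of the finite) subsets. On the other side, let X
   be the remainder of omega: the G_delta-modified topology of H(X) is given by the stabilizers of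
   countable families of clopen sets. It therefore suffices to let the symmetric group of a set S of size c
   act on X in a compatible way. It acts on the reduced power A^omega/fin, where A is the finite-cofinite
   algebra of S. This reduced power has size c and is countably saturated, so under CH a back-and-forth
   argument of length omega_1 (Parovicenko) identifies it with P(omega)/fin, the clopen algebra of X, and
   Stone duality turns its automorphisms into homeomorphisms of X. *)

theory Submission
  imports Defs "HOL-Library.Countable_Set_Type" "HOL-Algebra.Coset"
begin

section \<open>Layered algebras of sets\<close>

text \<open>The symmetric group has to act by a homomorphism, so automorphisms of
  \<open>P(omega)/fin\<close> cannot be chosen one by one; they are read off from a model built
  functorially from S, here \<open>nat set\<close>. The choice of A balances three demands. The
  power set of S would be too large, and most of its members are not determined by countably many
  points. A finite or cofinite set is preserved by every permutation fixing a finite set pointwise,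
  so a sequence of such sets is preserved by the pointwise stabilizer of a countable set: this
  yields continuity. The constant sequence at \<open>{t}\<close> is moved, even modulo finite, as
  soon as t is moved: this yields openness onto the image. A itself is not saturated (infinitely
  many singletons cannot be separated from infinitely many others), but sequences modulo finite are,
  and the coordinatewise action passes to them. Quotients are never formed. Both algebras are
  handled through representatives and the ideal of sets that meet only finitely many layers, which
  is fin for \<open>id\<close> on the integers and eventual vanishing for \<open>fst\<close> on
  sequences.\<close>

definition negligible_wrt :: "('x \<Rightarrow> nat) \<Rightarrow> 'x set \<Rightarrow> bool" where
  "negligible_wrt lev a \<longleftrightarrow> finite (lev ` a)"

lemma negligible_wrt_empty [simp]: "negligible_wrt lev {}"
  by (simp add: negligible_wrt_def)

lemma negligible_wrt_Un [simp]:
  "negligible_wrt lev (a \<union> b) \<longleftrightarrow> negligible_wrt lev a \<and> negligible_wrt lev b"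
  by (simp add: negligible_wrt_def image_Un)

lemma negligible_wrt_subset: "negligible_wrt lev b \<Longrightarrow> a \<subseteq> b \<Longrightarrow> negligible_wrt lev a"
  unfolding negligible_wrt_def by (meson finite_subset image_mono)

lemma negligible_wrt_UN:
  "finite I \<Longrightarrow> (\<And>i. i \<in> I \<Longrightarrow> negligible_wrt lev (f i)) \<Longrightarrow> negligible_wrt lev (\<Union>i\<in>I. f i)"
  by (induction rule: finite_induct) auto

definition set_algebra :: "'x set set \<Rightarrow> bool" where
  "set_algebra \<A> \<longleftrightarrow> {} \<in> \<A> \<and> (\<forall>a\<in>\<A>. - a \<in> \<A>) \<and> (\<forall>a\<in>\<A>. \<forall>b\<in>\<A>. a \<union> b \<in> \<A>)"

lemma set_algebra_Un: "set_algebra \<A> \<Longrightarrow> a \<in> \<A> \<Longrightarrow> b \<in> \<A> \<Longrightarrow> a \<union> b \<in> \<A>"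
  by (simp add: set_algebra_def)

lemma set_algebra_Compl: "set_algebra \<A> \<Longrightarrow> a \<in> \<A> \<Longrightarrow> - a \<in> \<A>"
  by (simp add: set_algebra_def)

lemma set_algebra_Int: "set_algebra \<A> \<Longrightarrow> a \<in> \<A> \<Longrightarrow> b \<in> \<A> \<Longrightarrow> a \<inter> b \<in> \<A>"
  using set_algebra_Compl[of \<A> "- a \<union> - b"] by (simp add: set_algebra_Un set_algebra_Compl)

lemma set_algebra_Diff: "set_algebra \<A> \<Longrightarrow> a \<in> \<A> \<Longrightarrow> b \<in> \<A> \<Longrightarrow> a - b \<in> \<A>"
  by (simp add: Diff_eq set_algebra_Int set_algebra_Compl)

text \<open>A layered algebra modulo its negligible sets is a countable product of algebras of sets modulo
  finite. Both \<open>P(\<omega>)/fin\<close> and the reduced power \<open>A\<^sup>\<omega>/fin\<close> of an algebra \<open>A\<close> are of this kind.\<close>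

definition layered_algebra :: "'x set set \<Rightarrow> ('x \<Rightarrow> nat) \<Rightarrow> bool" where
  "layered_algebra \<A> lev \<longleftrightarrow> set_algebra \<A> \<and> infinite (range lev) \<and>
     (\<forall>y. (\<forall>n. y n \<in> \<A>) \<longrightarrow> {x. x \<in> y (lev x)} \<in> \<A>)"

lemma layered_algebra_glue:
  "layered_algebra \<A> lev \<Longrightarrow> (\<And>n. y n \<in> \<A>) \<Longrightarrow> {x. x \<in> y (lev x)} \<in> \<A>"
  by (simp add: layered_algebra_def)

lemma layered_algebra_set_algebra: "layered_algebra \<A> lev \<Longrightarrow> set_algebra \<A>"
  by (simp add: layered_algebra_def)

text \<open>The layer \<open>t (prod_encode (j, r))\<close> is the \<open>r\<close>-th one reserved for the requirement on \<open>c j\<close>;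
  the parity of \<open>r\<close> decides whether \<open>y\<close> is there as small or as large as possible.\<close>

lemma layered_algebra_interpolation:
  fixes l m c :: "nat \<Rightarrow> 'x set"
  assumes lay: "layered_algebra \<A> lev"
    and l: "\<And>i. l i \<in> \<A>" and m: "\<And>i. m i \<in> \<A>"
    and disj: "\<And>i j. negligible_wrt lev (l i \<inter> m j)"
  obtains y where "y \<in> \<A>"
    "\<And>i. negligible_wrt lev (l i - y)" "\<And>i. negligible_wrt lev (m i \<inter> y)"
    "\<And>i. (\<And>k. \<not> negligible_wrt lev (c i - (\<Union>j\<le>k. l j))) \<Longrightarrow> \<not> negligible_wrt lev (c i - y)"
    "\<And>i. (\<And>k. \<not> negligible_wrt lev (c i - (\<Union>j\<le>k. m j))) \<Longrightarrow> \<not> negligible_wrt lev (c i \<inter> y)"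
proof -
  define L where "L k = (\<Union>j\<le>k. l j)" for k :: nat
  define M where "M k = (\<Union>j\<le>k. m j)" for k :: nat
  have sa: "set_algebra \<A>"
    by (rule layered_algebra_set_algebra[OF lay])
  have LA: "L k \<in> \<A>" and MA: "M k \<in> \<A>" for k
    unfolding L_def M_def
    by (induction k) (auto simp: l m atMost_Suc intro: set_algebra_Un[OF sa])
  have Lsub: "l i \<subseteq> L k" and Msub: "m i \<subseteq> M k" if "i \<le> k" for i k
    using that by (auto simp: L_def M_def)
  have LM: "negligible_wrt lev (L k \<inter> M k)" for k
  proof -
    have "L k \<inter> M k = (\<Union>i\<le>k. \<Union>j\<le>k. l i \<inter> m j)"
      by (auto simp: L_def M_def)
    also have "negligible_wrt lev \<dots>"
      by (intro negligible_wrt_UN disj) auto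
    finally show ?thesis .
  qed
  \<comment> \<open>From layer \<open>N k\<close> on, the finite unions \<open>L k\<close> and
    \<open>M k\<close> are disjoint, so any choice between \<open>L k\<close> and
    \<open>- M k\<close> is consistent there.\<close>
  have "\<exists>N. \<forall>x\<in>L k \<inter> M k. lev x < N" for k
    using LM[of k] unfolding negligible_wrt_def
    by (metis finite_nat_set_iff_bounded imageI)
  then obtain N where N: "\<And>k x. x \<in> L k \<Longrightarrow> x \<in> M k \<Longrightarrow> lev x < N k"
    by (metis IntI)
  define j where "j k = fst (prod_decode k)" for k
  define ev where "ev k \<longleftrightarrow> even (snd (prod_decode k))" for k
  \<comment> \<open>\<open>E0 k\<close> collects the layers at which the requirement of index
    \<open>k\<close> can be witnessed. If there are only finitely many, the requirement is void, and
    the default \<open>UNIV\<close> in \<open>E\<close> lets the choice of \<open>t\<close> go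
    on.\<close>
  define E0 where "E0 k = (if ev k then lev ` (c (j k) - L k) else lev ` (c (j k) - M k))" for k
  define E where "E k = (if infinite (E0 k) then E0 k else UNIV)" for k
  have infE: "infinite (E k)" for k
    by (simp add: E_def)
  have "\<exists>t. \<forall>k. (t k \<in> E k \<and> N k \<le> t k) \<and> t k < t (Suc k)"
  proof (rule dependent_nat_choice)
    show "\<exists>x. x \<in> E 0 \<and> N 0 \<le> x"
      using infE[of 0] infinite_nat_iff_unbounded_le by blast
  next
    fix x n
    show "\<exists>y. (y \<in> E (Suc n) \<and> N (Suc n) \<le> y) \<and> x < y"
      using infE[of "Suc n"] unfolding infinite_nat_iff_unbounded_le
      by (metis less_eq_Suc_le max.bounded_iff)
  qed
  then obtain t where tE: "\<And>k. t k \<in> E k" and tN: "\<And>k. N k \<le> t k" and "\<And>k. t k < t (Suc k)"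
    by blast
  then have t: "strict_mono t"
    by (simp add: strict_mono_Suc_iff)
  have fin: "finite {k. t k \<le> n}" for n
    by (rule finite_subset[of _ "{..n}"]) (use seq_suble[OF t] order_trans in auto)
  \<comment> \<open>The index of the last chosen layer up to \<open>n\<close>. Below
    \<open>t 0\<close> the maximum is over the empty set and has no meaning; this concerns finitely
    many layers only, whence the assumption \<open>t 0 \<le> n\<close> further on.\<close>
  define \<kappa> where "\<kappa> n = Max {k. t k \<le> n}" for n
  have \<kappa>t: "\<kappa> (t k) = k" for k
    unfolding \<kappa>_def using t by (intro Max_eqI fin) (auto simp: strict_mono_less_eq)
  have \<kappa>ge: "k \<le> \<kappa> n" if "t k \<le> n" for k n
    unfolding \<kappa>_def using that by (intro Max_ge fin) auto
  have \<kappa>le: "t (\<kappa> n) \<le> n" if "t 0 \<le> n" for n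
  proof -
    have "\<kappa> n \<in> {k. t k \<le> n}"
      unfolding \<kappa>_def using that by (intro Max_in fin) auto
    then show ?thesis by simp
  qed
  \<comment> \<open>By default the layer takes the lower bound \<open>L\<close>. Only at a chosen
    layer of odd parity is it as large as possible, namely \<open>- M\<close>, which still contains
    \<open>L\<close> there because the two unions are disjoint from \<open>N\<close> on.\<close>
  define Y where "Y n = (if n = t (\<kappa> n) \<and> \<not> ev (\<kappa> n) then - M (\<kappa> n) else L (\<kappa> n))" for n
  have YA: "Y n \<in> \<A>" for n
    by (simp add: Y_def LA MA set_algebra_Compl[OF sa])
  define y where "y = {x. x \<in> Y (lev x)}"
  have low: "lev x < t i" if "x \<in> l i - y" for x i
  proof (rule ccontr)
    assume "\<not> lev x < t i"
    then have *: "i \<le> \<kappa> (lev x)" "t 0 \<le> lev x"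
      using \<kappa>ge strict_mono_less_eq[OF t, of 0 i] by auto
    then have "x \<in> L (\<kappa> (lev x))" "N (\<kappa> (lev x)) \<le> lev x"
      using that Lsub[OF *(1)] \<kappa>le[OF *(2)] tN[of "\<kappa> (lev x)"] by auto
    then have "x \<in> Y (lev x)"
      using N[of x "\<kappa> (lev x)"] by (auto simp: Y_def)
    then show False
      using that by (simp add: y_def)
  qed
  have up: "lev x < t i" if "x \<in> m i \<inter> y" for x i
  proof (rule ccontr)
    assume "\<not> lev x < t i"
    then have *: "i \<le> \<kappa> (lev x)" "t 0 \<le> lev x"
      using \<kappa>ge strict_mono_less_eq[OF t, of 0 i] by auto
    then have "x \<in> M (\<kappa> (lev x))" "N (\<kappa> (lev x)) \<le> lev x"
      using that Msub[OF *(1)] \<kappa>le[OF *(2)] tN[of "\<kappa> (lev x)"] by auto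
    then have "x \<notin> Y (lev x)"
      using N[of x "\<kappa> (lev x)"] by (auto simp: Y_def)
    then show False
      using that by (simp add: y_def)
  qed
  \<comment> \<open>Every requirement recurs at infinitely many chosen layers, so a witness at each
    of them makes the resulting set meet infinitely many layers.\<close>
  have dense: "infinite (t ` {k. j k = i \<and> ev k = b})" for i b
  proof -
    have "inj (\<lambda>r. prod_encode (i, 2 * r + (if b then 0 else 1)))"
      by (auto simp: inj_def)
    then have "infinite (range (\<lambda>r. prod_encode (i, 2 * r + (if b then 0 else 1))))"
      using finite_imageD infinite_UNIV_nat by blast
    moreover have "range (\<lambda>r. prod_encode (i, 2 * r + (if b then 0 else 1))) \<subseteq> {k. j k = i \<and> ev k = b}"
      by (auto simp: j_def ev_def)
    ultimately have "infinite {k. j k = i \<and> ev k = b}"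
      using finite_subset by blast
    then show ?thesis
      using t by (simp add: finite_image_iff strict_mono_imp_inj_on)
  qed
  show ?thesis
  proof
    show "y \<in> \<A>"
      unfolding y_def by (rule layered_algebra_glue[OF lay YA])
    show "negligible_wrt lev (l i - y)" for i
      unfolding negligible_wrt_def by (rule finite_subset[of _ "{..<t i}"]) (use low in auto)
    show "negligible_wrt lev (m i \<inter> y)" for i
      unfolding negligible_wrt_def by (rule finite_subset[of _ "{..<t i}"]) (use up in auto)
    show "\<not> negligible_wrt lev (c i - y)"
      if "\<And>k. \<not> negligible_wrt lev (c i - (\<Union>j\<le>k. l j))" for i
    proof -
      have "t ` {k. j k = i \<and> ev k = True} \<subseteq> lev ` (c i - y)"
      proof safe
        fix k assume k: "ev k" "i = j k"
        have "t k \<in> lev ` (c i - L k)"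
          using tE[of k] that[of k] k by (auto simp: E_def E0_def negligible_wrt_def L_def)
        then obtain x where "t k = lev x" "x \<in> c i - L k"
          by blast
        then have "x \<in> c i - y"
          using \<kappa>t[of k] k by (simp add: y_def Y_def)
        with \<open>t k = lev x\<close> show "t k \<in> lev ` (c (j k) - y)"
          using k by blast
      qed
      then show ?thesis
        using dense[of i True] finite_subset unfolding negligible_wrt_def by blast
    qed
    show "\<not> negligible_wrt lev (c i \<inter> y)"
      if "\<And>k. \<not> negligible_wrt lev (c i - (\<Union>j\<le>k. m j))" for i
    proof -
      have "t ` {k. j k = i \<and> ev k = False} \<subseteq> lev ` (c i \<inter> y)"
      proof safe
        fix k assume k: "\<not> ev k" "i = j k"
        have "t k \<in> lev ` (c i - M k)"
          using tE[of k] that[of k] k by (auto simp: E_def E0_def negligible_wrt_def M_def)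
        then obtain x where "t k = lev x" "x \<in> c i - M k"
          by blast
        then have "x \<in> c i \<inter> y"
          using \<kappa>t[of k] k by (simp add: y_def Y_def)
        with \<open>t k = lev x\<close> show "t k \<in> lev ` (c (j k) \<inter> y)"
          using k by blast
      qed
      then show ?thesis
        using dense[of i False] finite_subset unfolding negligible_wrt_def by blast
    qed
  qed
qed

section \<open>Back and forth\<close>

text \<open>Isomorphisms between subalgebras of two quotients by negligible sets, given as relations between
  representatives.\<close>

definition partial_iso ::
    "'x set set \<Rightarrow> ('x \<Rightarrow> nat) \<Rightarrow> 'y set set \<Rightarrow> ('y \<Rightarrow> nat) \<Rightarrow> ('x set \<times> 'y set) set \<Rightarrow> bool" where
  "partial_iso \<A> lev \<B> lev' R \<longleftrightarrow> R \<subseteq> \<A> \<times> \<B> \<and> ({}, {}) \<in> R \<and>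
     (\<forall>a b. (a, b) \<in> R \<longrightarrow> (- a, - b) \<in> R) \<and>
     (\<forall>a b a' b'. (a, b) \<in> R \<and> (a', b') \<in> R \<longrightarrow> (a \<union> a', b \<union> b') \<in> R) \<and>
     (\<forall>a b. (a, b) \<in> R \<longrightarrow> (negligible_wrt lev a \<longleftrightarrow> negligible_wrt lev' b))"

lemma partial_isoD:
  assumes "partial_iso \<A> lev \<B> lev' R"
  shows "R \<subseteq> \<A> \<times> \<B>" "({}, {}) \<in> R"
    "(a, b) \<in> R \<Longrightarrow> (- a, - b) \<in> R"
    "(a, b) \<in> R \<Longrightarrow> (a', b') \<in> R \<Longrightarrow> (a \<union> a', b \<union> b') \<in> R"
    "(a, b) \<in> R \<Longrightarrow> negligible_wrt lev a \<longleftrightarrow> negligible_wrt lev' b"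
  using assms unfolding partial_iso_def by blast+

lemma partial_iso_Int:
  assumes "partial_iso \<A> lev \<B> lev' R" "(a, b) \<in> R" "(a', b') \<in> R"
  shows "(a \<inter> a', b \<inter> b') \<in> R"
proof -
  have "(- (- a \<union> - a'), - (- b \<union> - b')) \<in> R"
    by (intro partial_isoD(3,4)[OF assms(1)] assms(2,3))
  then show ?thesis by simp
qed

lemma partial_iso_Diff:
  assumes "partial_iso \<A> lev \<B> lev' R" "(a, b) \<in> R" "(a', b') \<in> R"
  shows "(a - a', b - b') \<in> R"
  unfolding Diff_eq by (intro partial_iso_Int[OF assms(1)] partial_isoD(3)[OF assms(1)] assms(2,3))

lemma partial_iso_UN:
  assumes "partial_iso \<A> lev \<B> lev' R" "\<And>i. (f i, g i) \<in> R"
  shows "((\<Union>i\<le>(k::nat). f i), (\<Union>i\<le>k. g i)) \<in> R"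
  by (induction k) (auto simp: assms(2) atMost_Suc intro: partial_isoD(4)[OF assms(1)])

lemma partial_iso_converse:
  "partial_iso \<A> lev \<B> lev' R \<Longrightarrow> partial_iso \<B> lev' \<A> lev (R\<inverse>)"
  unfolding partial_iso_def by blast

text \<open>The subalgebra generated by \<open>R\<close> and \<open>x\<close> is mapped consistently
  as soon as \<open>y\<close> lies over \<open>b\<close> exactly as \<open>x\<close> lies over
  \<open>a\<close>, for every \<open>(a, b)\<close> in \<open>R\<close>, as regards almost
  containing and almost missing. The pairs \<open>p\<close> demand containment and the pairs
  \<open>q\<close> demand disjointness; interpolation meets all these demands, and with the whole
  enumeration of \<open>R\<close> in the place of \<open>c\<close> it also prevents accidental
  ones.\<close>

lemma partial_iso_extend_left:
  assumes A: "layered_algebra \<A> lev" and B: "layered_algebra \<B> lev'"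
    and R: "partial_iso \<A> lev \<B> lev' R" and cR: "countable R" and x: "x \<in> \<A>"
  obtains R' y where "partial_iso \<A> lev \<B> lev' R'" "countable R'" "R \<subseteq> R'" "(x, y) \<in> R'"
proof -
  note neg = negligible_wrt_subset[where lev = lev] negligible_wrt_subset[where lev = lev']
  define r where "r = from_nat_into R"
  have "R \<noteq> {}"
    using partial_isoD(2)[OF R] by blast
  then have rR: "r i \<in> R" and ronto: "\<And>p. p \<in> R \<Longrightarrow> \<exists>i. r i = p" for i
    unfolding r_def by (auto simp: from_nat_into cR from_nat_into_surj)
  \<comment> \<open>The default \<open>({}, {})\<close> imposes no condition and makes
    \<open>p\<close> and \<open>q\<close> total sequences even when few members of \<open>R\<close>
    qualify.\<close>
  define p where "p i = (if negligible_wrt lev (fst (r i) - x) then r i else ({}, {}))" for i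
  define q where "q i = (if negligible_wrt lev (fst (r i) \<inter> x) then r i else ({}, {}))" for i
  have pR: "(fst (p i), snd (p i)) \<in> R" and qR: "(fst (q i), snd (q i)) \<in> R" for i
    using rR[of i] partial_isoD(2)[OF R] by (auto simp: p_def q_def)
  have pn: "negligible_wrt lev (fst (p i) - x)" and qn: "negligible_wrt lev (fst (q i) \<inter> x)" for i
    by (auto simp: p_def q_def)
  have pU: "((\<Union>j\<le>k. fst (p j)), (\<Union>j\<le>k. snd (p j))) \<in> R"
    and qU: "((\<Union>j\<le>k. fst (q j)), (\<Union>j\<le>k. snd (q j))) \<in> R" for k :: nat
    using pR qR by (auto intro: partial_iso_UN[OF R])
  have pB: "snd (p i) \<in> \<B>" and qB: "snd (q i) \<in> \<B>" for i
    using pR[of i] qR[of i] partial_isoD(1)[OF R] by auto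
  have disj: "negligible_wrt lev' (snd (p i) \<inter> snd (q j))" for i j
  proof -
    have "negligible_wrt lev (fst (p i) \<inter> fst (q j))"
      by (rule negligible_wrt_subset[of _ "(fst (p i) - x) \<union> (fst (q j) \<inter> x)"]) (use pn qn in auto)
    then show ?thesis
      using partial_isoD(5)[OF R partial_iso_Int[OF R pR qR]] by blast
  qed
  obtain y where y: "y \<in> \<B>"
    "\<And>i. negligible_wrt lev' (snd (p i) - y)" "\<And>i. negligible_wrt lev' (snd (q i) \<inter> y)"
    "\<And>i. (\<And>k. \<not> negligible_wrt lev' (snd (r i) - (\<Union>j\<le>k. snd (p j)))) \<Longrightarrow> \<not> negligible_wrt lev' (snd (r i) - y)"
    "\<And>i. (\<And>k. \<not> negligible_wrt lev' (snd (r i) - (\<Union>j\<le>k. snd (q j)))) \<Longrightarrow> \<not> negligible_wrt lev' (snd (r i) \<inter> y)"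
    using layered_algebra_interpolation[OF B, of "\<lambda>i. snd (p i)" "\<lambda>i. snd (q i)" "\<lambda>i. snd (r i)"] pB qB disj
    by blast
  have diff: "negligible_wrt lev (a - x) \<longleftrightarrow> negligible_wrt lev' (b - y)" if ab: "(a, b) \<in> R" for a b
  proof -
    obtain i where i: "r i = (a, b)"
      using ronto[OF ab] by blast
    show ?thesis
    proof
      assume "negligible_wrt lev (a - x)"
      then have "p i = (a, b)"
        by (simp add: p_def i)
      then show "negligible_wrt lev' (b - y)"
        using y(2)[of i] by simp
    next
      assume "negligible_wrt lev' (b - y)"
      \<comment> \<open>Were \<open>b\<close> not almost covered by finitely many
        \<open>snd (p j)\<close>, the choice of \<open>y\<close> would have left
        \<open>b - y\<close> non-negligible. A finite cover, unlike the full one, can be carried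
        back through \<open>R\<close>.\<close>
      then obtain k where k: "negligible_wrt lev' (b - (\<Union>j\<le>k. snd (p j)))"
        using y(4)[of i] i by auto
      have "negligible_wrt lev (a - (\<Union>j\<le>k. fst (p j)))"
        using partial_isoD(5)[OF R partial_iso_Diff[OF R ab pU]] k by blast
      moreover have "negligible_wrt lev (\<Union>j\<le>k. fst (p j) - x)"
        by (intro negligible_wrt_UN pn) simp
      ultimately have "negligible_wrt lev ((a - (\<Union>j\<le>k. fst (p j))) \<union> (\<Union>j\<le>k. fst (p j) - x))"
        by simp
      then show "negligible_wrt lev (a - x)"
        by (rule negligible_wrt_subset) auto
    qed
  qed
  have int: "negligible_wrt lev (a \<inter> x) \<longleftrightarrow> negligible_wrt lev' (b \<inter> y)" if ab: "(a, b) \<in> R" for a b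
  proof -
    obtain i where i: "r i = (a, b)"
      using ronto[OF ab] by blast
    show ?thesis
    proof
      assume "negligible_wrt lev (a \<inter> x)"
      then have "q i = (a, b)"
        by (simp add: q_def i)
      then show "negligible_wrt lev' (b \<inter> y)"
        using y(3)[of i] by simp
    next
      assume "negligible_wrt lev' (b \<inter> y)"
      then obtain k where k: "negligible_wrt lev' (b - (\<Union>j\<le>k. snd (q j)))"
        using y(5)[of i] i by auto
      have "negligible_wrt lev (a - (\<Union>j\<le>k. fst (q j)))"
        using partial_isoD(5)[OF R partial_iso_Diff[OF R ab qU]] k by blast
      moreover have "negligible_wrt lev (\<Union>j\<le>k. fst (q j) \<inter> x)"
        by (intro negligible_wrt_UN qn) simp
      ultimately have "negligible_wrt lev ((a - (\<Union>j\<le>k. fst (q j))) \<union> (\<Union>j\<le>k. fst (q j) \<inter> x))"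
        by simp
      then show "negligible_wrt lev (a \<inter> x)"
        by (rule negligible_wrt_subset) auto
    qed
  qed
  \<comment> \<open>Every member of the algebra generated by \<open>R\<close> and \<open>x\<close>
    has the form \<open>(a \<inter> x) \<union> (a' - x)\<close>, so no further closure is needed.
    Its negligibility splits into that of the two parts, which are settled by \<open>int\<close> and
    \<open>diff\<close>.\<close>
  define mix where
    "mix = (\<lambda>((a, b), (a', b')). ((a \<inter> x) \<union> (a' - x), (b \<inter> y) \<union> (b' - y)))"
  define R' where "R' = mix ` (R \<times> R)"
  have mixI: "((a \<inter> x) \<union> (a' - x), (b \<inter> y) \<union> (b' - y)) \<in> R'" if "(a, b) \<in> R" "(a', b') \<in> R" for a b a' b'
    using that by (force simp: R'_def mix_def)
  have mixE: "\<exists>a b a' b'. (a, b) \<in> R \<and> (a', b') \<in> R \<and> u = (a \<inter> x) \<union> (a' - x) \<and> v = (b \<inter> y) \<union> (b' - y)"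
    if "(u, v) \<in> R'" for u v
    using that by (auto simp: R'_def mix_def)
  have saA: "set_algebra \<A>" and saB: "set_algebra \<B>"
    using A B by (auto simp: layered_algebra_def)
  show ?thesis
  proof
    show "partial_iso \<A> lev \<B> lev' R'"
      unfolding partial_iso_def
    proof (intro conjI allI impI)
      show "R' \<subseteq> \<A> \<times> \<B>"
        using partial_isoD(1)[OF R] x y(1) mixE
        by (fast intro: set_algebra_Un[OF saA] set_algebra_Int[OF saA] set_algebra_Diff[OF saA]
           set_algebra_Un[OF saB] set_algebra_Int[OF saB] set_algebra_Diff[OF saB])
      show "({}, {}) \<in> R'"
        using mixI[OF partial_isoD(2)[OF R] partial_isoD(2)[OF R]] by simp
    next
      fix u v assume "(u, v) \<in> R'"
      then obtain a b a' b' where *: "(a, b) \<in> R" "(a', b') \<in> R"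
        "u = (a \<inter> x) \<union> (a' - x)" "v = (b \<inter> y) \<union> (b' - y)"
        using mixE by blast
      have "- u = (- a \<inter> x) \<union> (- a' - x)" "- v = (- b \<inter> y) \<union> (- b' - y)"
        using *(3,4) by auto
      then show "(- u, - v) \<in> R'"
        using mixI[OF partial_isoD(3)[OF R *(1)] partial_isoD(3)[OF R *(2)]] by simp
      show "negligible_wrt lev u \<longleftrightarrow> negligible_wrt lev' v"
        using *(3,4) int[OF *(1)] diff[OF *(2)] by simp
    next
      fix u v u' v' assume "(u, v) \<in> R' \<and> (u', v') \<in> R'"
      then obtain a b a' b' c d c' d' where *: "(a, b) \<in> R" "(a', b') \<in> R"
        "u = (a \<inter> x) \<union> (a' - x)" "v = (b \<inter> y) \<union> (b' - y)"
        "(c, d) \<in> R" "(c', d') \<in> R"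
        "u' = (c \<inter> x) \<union> (c' - x)" "v' = (d \<inter> y) \<union> (d' - y)"
        using mixE by meson
      have "u \<union> u' = ((a \<union> c) \<inter> x) \<union> ((a' \<union> c') - x)" "v \<union> v' = ((b \<union> d) \<inter> y) \<union> ((b' \<union> d') - y)"
        using * by auto
      then show "(u \<union> u', v \<union> v') \<in> R'"
        using mixI[OF partial_isoD(4)[OF R *(1,5)] partial_isoD(4)[OF R *(2,6)]] by simp
    qed
    show "countable R'"
      by (simp add: R'_def cR)
    show "R \<subseteq> R'"
    proof safe
      fix a b assume "(a, b) \<in> R"
      then show "(a, b) \<in> R'"
        using mixI[of a b a b] by (simp add: Int_Diff_Un)
    qed
    show "(x, y) \<in> R'"
      using mixI[OF partial_isoD(3)[OF R partial_isoD(2)[OF R]] partial_isoD(2)[OF R]] by simp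
  qed
qed

lemma partial_iso_extend_right:
  assumes A: "layered_algebra \<A> lev" and B: "layered_algebra \<B> lev'"
    and R: "partial_iso \<A> lev \<B> lev' R" and cR: "countable R" and y: "y \<in> \<B>"
  obtains R' x where "partial_iso \<A> lev \<B> lev' R'" "countable R'" "R \<subseteq> R'" "(x, y) \<in> R'"
proof -
  have conv: "countable (S\<inverse>)" if "countable S" for S :: "('p \<times> 'q) set"
    using countable_image[OF that, of prod.swap] by (rule countable_subset[rotated]) force
  obtain R' x where "partial_iso \<B> lev' \<A> lev R'" "countable R'" "R\<inverse> \<subseteq> R'" "(y, x) \<in> R'"
    using partial_iso_extend_left[OF B A partial_iso_converse[OF R] conv[OF cR] y] by blast
  then show ?thesis
    by (intro that[of "R'\<inverse>" x] partial_iso_converse conv) auto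
qed

lemma partial_iso_Union_chain:
  assumes "\<C> \<noteq> {}" "\<And>R. R \<in> \<C> \<Longrightarrow> partial_iso \<A> lev \<B> lev' R"
    and chain: "\<And>R S. R \<in> \<C> \<Longrightarrow> S \<in> \<C> \<Longrightarrow> R \<subseteq> S \<or> S \<subseteq> R"
  shows "partial_iso \<A> lev \<B> lev' (\<Union>\<C>)"
  unfolding partial_iso_def
proof (intro conjI allI impI)
  show "\<Union>\<C> \<subseteq> \<A> \<times> \<B>" "({}, {}) \<in> \<Union>\<C>"
    using assms(1) partial_isoD(1,2)[OF assms(2)] by blast+
next
  fix a b assume "(a, b) \<in> \<Union>\<C>"
  then show "(- a, - b) \<in> \<Union>\<C>" "negligible_wrt lev a = negligible_wrt lev' b"
    using partial_isoD(3,5)[OF assms(2)] by blast+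
next
  fix a b a' b' assume "(a, b) \<in> \<Union>\<C> \<and> (a', b') \<in> \<Union>\<C>"
  then obtain R where "R \<in> \<C>" "(a, b) \<in> R" "(a', b') \<in> R"
    using chain by blast
  then show "(a \<union> a', b \<union> b') \<in> \<Union>\<C>"
    using partial_isoD(4)[OF assms(2)] by blast
qed

text \<open>The infinite range of both level maps makes the full set non-negligible on both sides,
  so the two-element algebras correspond.\<close>

lemma partial_iso_trivial:
  assumes A: "layered_algebra \<A> lev" and B: "layered_algebra \<B> lev'"
  shows "partial_iso \<A> lev \<B> lev' {({}, {}), (UNIV, UNIV)}"
  using assms set_algebra_Compl[of \<A> "{}"] set_algebra_Compl[of \<B> "{}"]
  by (auto simp: partial_iso_def layered_algebra_def set_algebra_def negligible_wrt_def)

text \<open>Under the continuum hypothesis an enumeration of length \<open>\<omega>\<^sub>1\<close> exhausts both algebras, and all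
  stages of the construction remain countable.\<close>

theorem layered_algebras_isomorphic:
  fixes \<A> :: "'x set set" and \<B> :: "'y set set"
  assumes CH and A: "layered_algebra \<A> lev" and B: "layered_algebra \<B> lev'"
    and cA: "|\<A>| \<le>o continuum" and cB: "|\<B>| \<le>o continuum"
  obtains R where "partial_iso \<A> lev \<B> lev' R" "fst ` R = \<A>" "snd ` R = \<B>"
proof -
  define r where "r = cardSuc natLeq"
  have cr: "Card_order r"
    by (simp add: r_def natLeq_Card_order cardSuc_Card_order)
  then have wo: "Well_order r"
    using card_order_on_well_order_on by blast
  have wf: "wf (r - Id)"
    using wo by (simp add: well_order_on_def)
  have cU: "countable (underS r x)" for x
  proof (cases "x \<in> Field r")
    case True
    then have "|underS r x| <o r"
      by (rule card_of_underS[OF cr])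
    then have "|underS r x| \<le>o natLeq"
      unfolding r_def using cardSuc_ordLeq_ordLess[OF natLeq_Card_order card_of_Card_order] by blast
    then show ?thesis
      by (simp add: countable_card_le_natLeq)
  next
    case False
    then have "underS r x = {}"
      by (auto simp: underS_def Field_def)
    then show ?thesis by simp
  qed
  \<comment> \<open>The one appeal to CH: it lets sets of size at most the continuum be enumerated
    along \<open>r\<close>, whose proper initial segments are countable.\<close>
  have r: "continuum =o |Field r|"
  proof -
    have "continuum =o r"
      using \<open>CH\<close> ordIso_symmetric by (auto simp: CH_def r_def)
    moreover have "r =o |Field r|"
      using card_of_Field_ordIso[OF cr] ordIso_symmetric by blast
    ultimately show ?thesis
      using ordIso_transitive by blast
  qed
  \<comment> \<open>Values outside the field of \<open>r\<close> are set to some member of the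
    enumerated set, because the recursion runs over the whole type.\<close>
  have enum: "\<exists>e :: nat set \<Rightarrow> 'z. e ` Field r = \<Z> \<and> range e = \<Z>"
    if ne: "\<Z> \<noteq> {}" and le: "|\<Z>| \<le>o continuum" for \<Z> :: "'z set"
  proof -
    have "|\<Z>| \<le>o |Field r|"
      by (rule ordLeq_ordIso_trans[OF le r])
    then have "\<exists>g. g ` Field r = \<Z>"
      by (rule iffD2[OF card_of_ordLeq2[OF ne]])
    then obtain g where g: "g ` Field r = \<Z>"
      by blast
    obtain z where "z \<in> \<Z>"
      using ne by blast
    then show ?thesis
      using g by (intro exI[of _ "\<lambda>x. if x \<in> Field r then g x else z"]) auto
  qed
  have "\<A> \<noteq> {}" "\<B> \<noteq> {}"
    using A B by (auto simp: layered_algebra_def set_algebra_def)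
  then obtain e e' where e: "e ` Field r = \<A>" "range e = \<A>" and e': "e' ` Field r = \<B>" "range e' = \<B>"
    using enum[OF _ cA] enum[OF _ cB] by metis
  \<comment> \<open>Added to every union of earlier stages, so that stages without predecessors also
    start from a partial isomorphism.\<close>
  let ?R0 = "{({}, {}), (UNIV, UNIV)} :: ('x set \<times> 'y set) set"
  \<comment> \<open>A stage contains all earlier ones and settles the \<open>x\<close>-th member of
    each algebra, by one extension on the left followed by one on the right.\<close>
  let ?P = "\<lambda>f x S. partial_iso \<A> lev \<B> lev' S \<and> countable S \<and>
    (\<forall>z. (z, x) \<in> r - Id \<longrightarrow> f z \<subseteq> S) \<and> e x \<in> fst ` S \<and> e' x \<in> snd ` S"
  have trans_r: "trans r" and anti_r: "antisym r" and tot_r: "total_on (Field r) r"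
    using wo by (auto simp: well_order_on_def linear_order_on_def partial_order_on_def preorder_on_def)
  have "\<exists>f. \<forall>x. ?P f x (f x)"
  proof (rule dependent_wf_choice[OF wf])
    fix f g :: "nat set \<Rightarrow> ('x set \<times> 'y set) set" and x S
    assume "\<And>z. (z, x) \<in> r - Id \<Longrightarrow> f z = g z"
    then show "?P f x S = ?P g x S" by auto
  next
    fix x f
    assume f: "\<And>y. (y, x) \<in> r - Id \<Longrightarrow> ?P f y (f y)"
    define U where "U = \<Union> (insert ?R0 (f ` underS r x))"
    have under: "(y, x) \<in> r - Id" if "y \<in> underS r x" for y
      using that by (auto simp: underS_def)
    have "?R0 \<subseteq> f y" if "y \<in> underS r x" for y
    proof -
      have p: "partial_iso \<A> lev \<B> lev' (f y)"
        using f[OF under[OF that]] by blast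
      show ?thesis
        using partial_isoD(2)[OF p] partial_isoD(3)[OF p partial_isoD(2)[OF p]] by simp
    qed
    moreover have "f y \<subseteq> f z \<or> f z \<subseteq> f y" if "y \<in> underS r x" "z \<in> underS r x" for y z
    proof (cases "y = z")
      case False
      then have "(y, z) \<in> r - Id \<or> (z, y) \<in> r - Id"
        using tot_r that by (auto simp: total_on_def underS_def Field_def)
      then show ?thesis
        using f[OF under[OF that(1)]] f[OF under[OF that(2)]] by blast
    qed auto
    ultimately have "partial_iso \<A> lev \<B> lev' U"
      unfolding U_def
      by (intro partial_iso_Union_chain)
         (use partial_iso_trivial[OF A B] f[OF under] in auto)
    moreover have "countable U"
    proof -
      have "U = ?R0 \<union> (\<Union>y\<in>underS r x. f y)"
        by (simp add: U_def)
      moreover have "countable (\<Union>y\<in>underS r x. f y)"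
        using f[OF under] by (intro countable_UN cU) blast
      ultimately show ?thesis
        by simp
    qed
    moreover have "e x \<in> \<A>" "e' x \<in> \<B>"
      using e(2) e'(2) by blast+
    ultimately obtain S1 y where S1: "partial_iso \<A> lev \<B> lev' S1" "countable S1" "U \<subseteq> S1" "(e x, y) \<in> S1"
      using partial_iso_extend_left[OF A B] by metis
    then obtain S x' where S: "partial_iso \<A> lev \<B> lev' S" "countable S" "S1 \<subseteq> S" "(x', e' x) \<in> S"
      using partial_iso_extend_right[OF A B] \<open>e' x \<in> \<B>\<close> by metis
    have "f z \<subseteq> S" if "(z, x) \<in> r - Id" for z
      using that S1(3) S(3) by (auto simp: U_def underS_def)
    moreover have "e x \<in> fst ` S" "e' x \<in> snd ` S"
      using S1(4) S(3,4) by force+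
    ultimately show "\<exists>S. ?P f x S"
      using S(1,2) by blast
  qed
  then obtain f where f: "\<And>x. ?P f x (f x)"
    by blast
  define R where "R = (\<Union>x\<in>Field r. f x)"
  have "Field r \<noteq> {}"
    using e(1) \<open>\<A> \<noteq> {}\<close> by blast
  have "partial_iso \<A> lev \<B> lev' R"
    unfolding R_def
  proof (rule partial_iso_Union_chain)
    fix S T assume "S \<in> f ` Field r" "T \<in> f ` Field r"
    then obtain y z where yz: "y \<in> Field r" "z \<in> Field r" "S = f y" "T = f z"
      by blast
    show "S \<subseteq> T \<or> T \<subseteq> S"
    proof (cases "y = z")
      case False
      then have "(y, z) \<in> r - Id \<or> (z, y) \<in> r - Id"
        using tot_r yz by (auto simp: total_on_def)
      then show ?thesis
        using f yz by blast
    qed (use yz in auto)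
  qed (use f \<open>Field r \<noteq> {}\<close> in auto)
  moreover have "e x \<in> fst ` R" "e' x \<in> snd ` R" if "x \<in> Field r" for x
  proof -
    have "f x \<subseteq> R"
      using that by (auto simp: R_def)
    then show "e x \<in> fst ` R" "e' x \<in> snd ` R"
      using f[of x] by blast+
  qed
  then have "\<A> \<subseteq> fst ` R" "\<B> \<subseteq> snd ` R"
    using e(1) e'(1) by blast+
  moreover have "fst ` R \<subseteq> \<A>" "snd ` R \<subseteq> \<B>"
    using partial_isoD(1)[OF \<open>partial_iso \<A> lev \<B> lev' R\<close>] by auto
  ultimately show ?thesis
    using that by blast
qed

section \<open>The remainder of the integers\<close>

abbreviation beta_omega :: "((nat \<Rightarrow> real) \<Rightarrow> real) topology" where
  "beta_omega \<equiv> cech_stone (discrete_topology (UNIV :: nat set))"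

abbreviation omega_units :: "(nat \<Rightarrow> real) set" where
  "omega_units \<equiv> unit_functions (discrete_topology (UNIV :: nat set))"

abbreviation omega_point :: "nat \<Rightarrow> (nat \<Rightarrow> real) \<Rightarrow> real" where
  "omega_point \<equiv> evaluation (discrete_topology (UNIV :: nat set))"

section \<open>Points of the compactification and their values on unit functions\<close>

lemma omega_units_iff: "f \<in> omega_units \<longleftrightarrow> (\<forall>n. 0 \<le> f n \<and> f n \<le> 1)"
  by (auto simp: unit_functions_def Pi_iff)

lemma indicator_omega_units [simp]: "(indicat_real A :: nat \<Rightarrow> real) \<in> omega_units"
  by (simp add: omega_units_iff)

lemma omega_point_apply: "f \<in> omega_units \<Longrightarrow> omega_point n f = f n"
  by (simp add: evaluation_def)

lemma omega_point_in_cube: "omega_point n \<in> omega_units \<rightarrow>\<^sub>E {0..1}"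
  by (auto simp: evaluation_def omega_units_iff)

lemma beta_omega_eq:
  "beta_omega = subtopology (product_topology (\<lambda>f. top_of_set {0..1}) omega_units)
     (product_topology (\<lambda>f. top_of_set {0..1}) omega_units closure_of range omega_point)"
  by (simp add: cech_stone_def Let_def)

lemma topspace_beta_omega:
  "topspace beta_omega = product_topology (\<lambda>f. top_of_set {0..1}) omega_units closure_of range omega_point"
  unfolding beta_omega_eq topspace_subtopology by (intro Int_absorb1 closure_of_subset_topspace)

lemma topspace_beta_omega_subset: "topspace beta_omega \<subseteq> omega_units \<rightarrow>\<^sub>E {0..1}"
  unfolding topspace_beta_omega
  using closure_of_subset_topspace[of "product_topology (\<lambda>f. top_of_set {0..1}) omega_units"]
  by simp

lemma omega_point_in_beta: "omega_point n \<in> topspace beta_omega"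
proof -
  have "range omega_point \<subseteq> topspace (product_topology (\<lambda>f. top_of_set {0..1}) omega_units)"
    using omega_point_in_cube by auto
  then show ?thesis
    unfolding topspace_beta_omega using closure_of_subset by blast
qed

lemma continuous_map_cube_coordinate:
  assumes "f \<in> I"
  shows "continuous_map (product_topology (\<lambda>f. top_of_set {0..1}) I) euclideanreal (\<lambda>p. p f)"
  using continuous_map_product_coordinates[OF assms, of "\<lambda>f. top_of_set {0..1::real}"]
  unfolding continuous_map_in_subtopology by blast

lemma continuous_map_beta_coordinate:
  assumes "f \<in> omega_units"
  shows "continuous_map beta_omega euclideanreal (\<lambda>p. p f)"
  unfolding beta_omega_eq
  by (rule continuous_map_from_subtopology[OF continuous_map_cube_coordinate[OF assms]])

text \<open>\<open>p\<close> lies in the closure of the integers in a product, so finitely many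
  coordinates are approximated by one and the same integer. This replaces the description of points
  as ultrafilters.\<close>

lemma beta_omega_approx:
  assumes "p \<in> topspace beta_omega" and "finite F" "F \<subseteq> omega_units" "0 < e"
  obtains n where "\<And>f. f \<in> F \<Longrightarrow> \<bar>p f - f n\<bar> < e"
proof -
  let ?Q = "product_topology (\<lambda>f. top_of_set {0..1::real}) omega_units"
  let ?T = "{q \<in> topspace ?Q. \<forall>f\<in>F. q f \<in> {p f - e<..<p f + e}}"
  have "openin ?Q {q \<in> topspace ?Q. q f \<in> {p f - e<..<p f + e}}" if "f \<in> F" for f
  proof (rule openin_continuous_map_preimage[where Y = euclideanreal])
    show "continuous_map ?Q euclideanreal (\<lambda>q. q f)"
      using that assms(3) by (intro continuous_map_cube_coordinate) auto
  qed auto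
  then have "openin ?Q ((\<Inter>f\<in>F. {q \<in> topspace ?Q. q f \<in> {p f - e<..<p f + e}}) \<inter> topspace ?Q)"
    by (rule openin_INT[OF assms(2)])
  moreover have "(\<Inter>f\<in>F. {q \<in> topspace ?Q. q f \<in> {p f - e<..<p f + e}}) \<inter> topspace ?Q = ?T"
    by auto
  moreover have "p \<in> ?T"
    using assms(1,4) topspace_beta_omega_subset by auto
  moreover have "p \<in> ?Q closure_of range omega_point"
    using assms(1) by (simp add: topspace_beta_omega)
  ultimately obtain n where "omega_point n \<in> ?T"
    unfolding in_closure_of by (metis (no_types, lifting) rangeE)
  then show ?thesis
    using assms(3) by (intro that[of n]) (force simp: omega_point_apply abs_less_iff)
qed

text \<open>The hypothesis on the indicator says that \<open>A\<close> belongs to the ultrafilter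
  \<open>p\<close>; bounds that hold on such a set pass to the limit.\<close>

lemma beta_omega_value_le:
  assumes p: "p \<in> topspace beta_omega" and pA: "p (indicat_real A) \<noteq> 0"
    and f: "f \<in> omega_units" and bound: "\<And>n. n \<in> A \<Longrightarrow> \<bar>f n - c\<bar> \<le> b"
  shows "\<bar>p f - c\<bar> \<le> b"
proof (rule field_le_epsilon)
  fix e :: real assume "0 < e"
  \<comment> \<open>The tolerance \<open>\<bar>p (indicat_real A)\<bar>\<close> excludes integers
    outside \<open>A\<close>, where the indicator is zero and the error would be exactly that
    large.\<close>
  then obtain n where n: "\<And>g. g \<in> {f, indicat_real A} \<Longrightarrow> \<bar>p g - g n\<bar> < min e \<bar>p (indicat_real A)\<bar>"
    using beta_omega_approx[OF p, of "{f, indicat_real A}" "min e \<bar>p (indicat_real A)\<bar>"] f pA by auto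
  then have "n \<in> A" "\<bar>p f - f n\<bar> < e"
    using n[of "indicat_real A"] n[of f] by (cases "n \<in> A"; simp)+
  then show "\<bar>p f - c\<bar> \<le> b + e"
    using bound[of n] by linarith
qed

lemma beta_omega_indicator_01:
  assumes "p \<in> topspace beta_omega"
  shows "p (indicat_real A) = 0 \<or> p (indicat_real A) = 1"
  using beta_omega_value_le[OF assms, of A "indicat_real A" 1 0] by auto

lemma beta_omega_indicator_Compl:
  assumes "p \<in> topspace beta_omega"
  shows "p (indicat_real (- A)) = 1 - p (indicat_real A)"
proof (cases "p (indicat_real A) = 0")
  case True
  obtain n where n: "\<And>g. g \<in> {indicat_real A, indicat_real (- A)} \<Longrightarrow> \<bar>p g - g n\<bar> < 1"
    using beta_omega_approx[OF assms, of "{indicat_real A, indicat_real (- A)}" 1] by auto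
  have "n \<notin> A"
    using n[of "indicat_real A"] True by (auto simp: indicator_def split: if_splits)
  then have "\<bar>p (indicat_real (- A)) - 1\<bar> < 1"
    using n[of "indicat_real (- A)"] by simp
  then show ?thesis
    using beta_omega_indicator_01[OF assms, of "- A"] True by auto
next
  case False
  then show ?thesis
    using beta_omega_value_le[OF assms False, of "indicat_real (- A)" 0 0]
      beta_omega_indicator_01[OF assms, of A] by auto
qed

lemma beta_omega_indicator_mono:
  assumes "p \<in> topspace beta_omega" "A \<subseteq> B" "p (indicat_real A) = 1"
  shows "p (indicat_real B) = 1"
  using beta_omega_value_le[OF assms(1), of A "indicat_real B" 1 0] assms(2,3)
  by (auto simp: indicator_def subset_iff)

lemma beta_omega_singleton:
  assumes p: "p \<in> topspace beta_omega" and pn: "p (indicat_real {n}) \<noteq> 0"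
  shows "p = omega_point n"
proof
  fix f
  show "p f = omega_point n f"
  proof (cases "f \<in> omega_units")
    case True
    then show ?thesis
      using beta_omega_value_le[OF p pn True, of "f n" 0] by (simp add: omega_point_apply)
  next
    case False
    then show ?thesis
      using p topspace_beta_omega_subset omega_point_in_cube[of n] by (auto simp: PiE_def extensional_def)
  qed
qed

lemma compact_space_beta_omega: "compact_space beta_omega"
  unfolding beta_omega_eq
  by (intro compact_space_subtopology closedin_compact_space)
     (auto simp: compact_space_product_topology compact_space_subtopology)

lemma Hausdorff_space_beta_omega: "Hausdorff_space beta_omega"
  unfolding beta_omega_eq
  by (intro Hausdorff_space_subtopology) (simp add: Hausdorff_space_product_topology Hausdorff_space_subtopology)

lemma omega_star_eq: "omega_star = subtopology beta_omega (topspace beta_omega - range omega_point)"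
  by (simp add: cech_stone_remainder_def)

lemma topspace_omega_star: "topspace omega_star = topspace beta_omega - range omega_point"
  by (auto simp: omega_star_eq)

lemma topspace_omega_star_subset: "topspace omega_star \<subseteq> topspace beta_omega"
  by (auto simp: topspace_omega_star)

lemma openin_omega_point: "openin beta_omega {omega_point n}"
proof -
  have "{omega_point n} = {p \<in> topspace beta_omega. p (indicat_real {n}) \<in> - {0}}"
  proof (intro equalityI subsetI)
    fix p assume "p \<in> {omega_point n}"
    then show "p \<in> {p \<in> topspace beta_omega. p (indicat_real {n}) \<in> - {0}}"
      by (simp add: omega_point_in_beta omega_point_apply)
  next
    fix p assume "p \<in> {p \<in> topspace beta_omega. p (indicat_real {n}) \<in> - {0}}"
    then show "p \<in> {omega_point n}"
      using beta_omega_singleton[of p n] by simp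
  qed
  then show ?thesis
    by (simp only: openin_continuous_map_preimage[OF continuous_map_beta_coordinate[OF indicator_omega_units]]
        open_openin[symmetric] open_Compl closed_singleton)
qed

lemma closedin_topspace_omega_star: "closedin beta_omega (topspace omega_star)"
proof -
  have "openin beta_omega (\<Union>n. {omega_point n})"
    by (intro openin_Union) (auto simp: openin_omega_point)
  then show ?thesis
    by (simp add: topspace_omega_star UNION_singleton_eq_range closedin_diff)
qed

lemma compact_space_omega_star: "compact_space omega_star"
  using closedin_compact_space[OF compact_space_beta_omega closedin_topspace_omega_star]
  by (metis compact_space_subtopology omega_star_eq topspace_omega_star)

lemma Hausdorff_space_omega_star: "Hausdorff_space omega_star"
  unfolding omega_star_eq by (intro Hausdorff_space_subtopology Hausdorff_space_beta_omega)

section \<open>The clopen algebra of the remainder\<close>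

definition clopen_sets :: "'a topology \<Rightarrow> 'a set set" where
  "clopen_sets X = {U. openin X U \<and> closedin X U}"

lemma clopen_setsD: "U \<in> clopen_sets X \<Longrightarrow> openin X U" "U \<in> clopen_sets X \<Longrightarrow> closedin X U"
  by (auto simp: clopen_sets_def)

lemma clopen_sets_subset: "U \<in> clopen_sets X \<Longrightarrow> U \<subseteq> topspace X"
  using clopen_setsD(1) openin_subset by blast

lemma clopen_sets_closed:
  "{} \<in> clopen_sets X" "topspace X \<in> clopen_sets X"
  "U \<in> clopen_sets X \<Longrightarrow> topspace X - U \<in> clopen_sets X"
  "U \<in> clopen_sets X \<Longrightarrow> V \<in> clopen_sets X \<Longrightarrow> U \<union> V \<in> clopen_sets X"
  "U \<in> clopen_sets X \<Longrightarrow> V \<in> clopen_sets X \<Longrightarrow> U \<inter> V \<in> clopen_sets X"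
  by (auto simp: clopen_sets_def openin_Un closedin_Un)

text \<open>The classical \<open>A*\<close>: the trace on the remainder of the closure of
  \<open>A\<close>, that is, the free ultrafilters containing \<open>A\<close>.\<close>

definition star :: "nat set \<Rightarrow> ((nat \<Rightarrow> real) \<Rightarrow> real) set" where
  "star A = {p \<in> topspace omega_star. p (indicat_real A) = 1}"

lemma star_subset: "star A \<subseteq> topspace omega_star"
  by (auto simp: star_def)

lemma star_Compl: "star (- A) = topspace omega_star - star A"
  using beta_omega_indicator_Compl beta_omega_indicator_01 topspace_omega_star_subset
  by (fastforce simp: star_def)

lemma star_mono: "A \<subseteq> B \<Longrightarrow> star A \<subseteq> star B"
  using beta_omega_indicator_mono topspace_omega_star_subset by (auto simp: star_def)

lemma star_Un: "star (A \<union> B) = star A \<union> star B"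
proof
  show "star (A \<union> B) \<subseteq> star A \<union> star B"
  proof
    fix p assume p: "p \<in> star (A \<union> B)"
    then have pb: "p \<in> topspace beta_omega" "p \<in> topspace omega_star"
      using star_subset topspace_omega_star_subset by auto
    let ?F = "{indicat_real A, indicat_real B, indicat_real (A \<union> B)}"
    obtain n where n: "\<And>g. g \<in> ?F \<Longrightarrow> \<bar>p g - g n\<bar> < 1"
      using beta_omega_approx[OF pb(1), of ?F 1] by auto
    have "n \<in> A \<union> B"
      using n[of "indicat_real (A \<union> B)"] p by (auto simp: star_def indicator_def split: if_splits)
    then have "p (indicat_real A) \<noteq> 0 \<or> p (indicat_real B) \<noteq> 0"
      using n[of "indicat_real A"] n[of "indicat_real B"] by (auto simp: indicator_def split: if_splits)
    then show "p \<in> star A \<union> star B"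
      using pb beta_omega_indicator_01 by (auto simp: star_def)
  qed
qed (simp add: star_mono)

lemma star_UN: "finite I \<Longrightarrow> I \<noteq> {} \<Longrightarrow> star (\<Union>i\<in>I. A i) = (\<Union>i\<in>I. star (A i))"
  by (induction rule: finite_ne_induct) (auto simp: star_Un)

lemma star_clopen: "star A \<in> clopen_sets omega_star"
proof -
  have "openin omega_star (star A)" for A
  proof -
    have "continuous_map omega_star euclideanreal (\<lambda>p. p (indicat_real A))"
      unfolding omega_star_eq
      by (intro continuous_map_from_subtopology continuous_map_beta_coordinate indicator_omega_units)
    then have "openin omega_star {p \<in> topspace omega_star. p (indicat_real A) \<in> - {0}}"
      by (rule openin_continuous_map_preimage) auto
    moreover have "{p \<in> topspace omega_star. p (indicat_real A) \<in> - {0}} = star A"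
      using beta_omega_indicator_01 topspace_omega_star_subset by (fastforce simp: star_def)
    ultimately show ?thesis by simp
  qed
  from this[of A] this[of "- A"] show ?thesis
    by (simp add: clopen_sets_def closedin_def star_subset star_Compl)
qed

text \<open>Points containing a singleton are integers, hence finite sets have no trace. For
  infinite \<open>A\<close> the closed sets of points containing \<open>A - {..k}\<close> are nested
  and nonempty; compactness provides a common point, which differs from each integer
  \<open>k\<close> because it contains a set missing \<open>k\<close>.\<close>

lemma star_empty_iff: "star A = {} \<longleftrightarrow> finite A"
proof
  assume "finite A"
  have single: "star {n} = {}" for n
  proof -
    have False if "p \<in> star {n}" for p
      using that beta_omega_singleton[of p n] by (auto simp: star_def topspace_omega_star)
    then show ?thesis by blast
  qed
  then have "star {} = {}"
    using star_mono[of "{}" "{0}"] by simp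
  then show "star A = {}"
    using star_UN[OF \<open>finite A\<close>, of "\<lambda>n. {n}"] single by (cases "A = {}") simp_all
next
  assume empty: "star A = {}"
  show "finite A"
  proof (rule ccontr)
    assume A: "infinite A"
    define C where "C k = {p \<in> topspace beta_omega. p (indicat_real (A - {..k})) \<in> {1}}" for k
    have "(\<Inter>k. C k) \<noteq> {}"
    proof (rule compact_space_imp_nest[OF compact_space_beta_omega])
      show "closedin beta_omega (C k)" for k
        unfolding C_def
        by (rule closedin_continuous_map_preimage[OF continuous_map_beta_coordinate]) auto
      show "C k \<noteq> {}" for k
      proof -
        obtain n where "n \<in> A" "k < n"
          using A by (meson infinite_nat_iff_unbounded)
        then have "omega_point n \<in> C k"
          by (simp add: C_def omega_point_in_beta omega_point_apply)
        then show ?thesis by blast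
      qed
      show "decseq C"
        by (rule decseq_SucI) (auto simp: C_def elim!: beta_omega_indicator_mono[rotated 2])
    qed
    then obtain p where p: "\<And>k. p \<in> C k"
      by blast
    have "p \<noteq> omega_point k" for k
      using p[of k] by (auto simp: C_def omega_point_apply)
    then have "p \<in> star A"
      using p[of 0] beta_omega_indicator_mono[of p "A - {..0}" A]
      by (auto simp: C_def star_def topspace_omega_star)
    then show False
      using empty by blast
  qed
qed

text \<open>A basic neighbourhood of \<open>p\<close> restricts finitely many coordinates. The
  integers at which these functions are close to their values at \<open>p\<close> form a set whose
  trace contains \<open>p\<close> and satisfies the same restrictions.\<close>

lemma star_base:
  assumes U: "openin omega_star U" and p: "p \<in> U"
  obtains A where "p \<in> star A" "star A \<subseteq> U"
proof -
  let ?Q = "product_topology (\<lambda>f. top_of_set {0..1::real}) omega_units"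
  have "omega_star = subtopology ?Q (topspace omega_star)"
    unfolding topspace_omega_star
    by (subst omega_star_eq, subst beta_omega_eq) (simp add: subtopology_subtopology topspace_beta_omega Int_absorb1)
  then obtain W where W: "openin ?Q W" "U = W \<inter> topspace omega_star"
    using U by (metis openin_subtopology)
  then obtain V where V: "finite {f \<in> omega_units. V f \<noteq> {0..1}}"
    "\<And>f. f \<in> omega_units \<Longrightarrow> openin (top_of_set {0..1}) (V f)"
    "p \<in> Pi\<^sub>E omega_units V" "Pi\<^sub>E omega_units V \<subseteq> W"
    using p unfolding openin_product_topology_alt by auto
  define F where "F = {f \<in> omega_units. V f \<noteq> {0..1}}"
  have pb: "p \<in> topspace beta_omega" "p \<in> topspace omega_star"
    using W p topspace_omega_star_subset by auto
  have "\<exists>e>0. \<forall>x\<in>{0..1}. \<bar>x - p f\<bar> < e \<longrightarrow> x \<in> V f" if "f \<in> F" for f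
  proof -
    have "p f \<in> V f" "openin (top_of_set {0..1}) (V f)"
      using that V(2,3) by (auto simp: F_def)
    then show ?thesis
      unfolding openin_euclidean_subtopology_iff by (fastforce simp: dist_real_def)
  qed
  then obtain e where e: "\<And>f. f \<in> F \<Longrightarrow> 0 < e f"
    "\<And>f x. f \<in> F \<Longrightarrow> x \<in> {0..1} \<Longrightarrow> \<bar>x - p f\<bar> < e f \<Longrightarrow> x \<in> V f"
    by metis
  \<comment> \<open>The inserted 1 keeps the minimum defined when no coordinate is
    restricted.\<close>
  define d where "d = Min (insert 1 (e ` F))"
  have "finite F"
    using V(1) by (simp add: F_def)
  then have d: "0 < d" "\<And>f. f \<in> F \<Longrightarrow> d \<le> e f"
    using e(1) by (auto simp: d_def)
  \<comment> \<open>Half the radius: only the non-strict bound survives the passage from the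
    integers in \<open>A\<close> to the points of \<open>star A\<close>.\<close>
  define A where "A = {n. \<forall>f\<in>F. \<bar>f n - p f\<bar> < d / 2}"
  have "p \<in> star A"
  proof -
    obtain n where n: "\<And>g. g \<in> insert (indicat_real A) F \<Longrightarrow> \<bar>p g - g n\<bar> < min 1 (d / 2)"
      using beta_omega_approx[OF pb(1), of "insert (indicat_real A) F" "min 1 (d / 2)"] \<open>finite F\<close> d(1)
      by (auto simp: F_def)
    then have "n \<in> A"
      by (auto simp: A_def abs_minus_commute)
    then have "p (indicat_real A) \<noteq> 0"
      using n[of "indicat_real A"] by auto
    then show ?thesis
      using beta_omega_indicator_01[OF pb(1)] pb(2) by (auto simp: star_def)
  qed
  moreover have "star A \<subseteq> U"
  proof
    fix q assume q: "q \<in> star A"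
    then have qb: "q \<in> topspace beta_omega" "q (indicat_real A) \<noteq> 0" "q \<in> topspace omega_star"
      using star_subset topspace_omega_star_subset by (auto simp: star_def)
    have "q f \<in> V f" if f: "f \<in> omega_units" for f
    proof -
      have "q f \<in> {0..1}"
        using PiE_mem[OF subsetD[OF topspace_beta_omega_subset qb(1)] f] .
      moreover have "\<bar>q f - p f\<bar> \<le> d / 2" if "f \<in> F"
        using that f by (intro beta_omega_value_le[OF qb(1,2)]) (auto simp: A_def less_imp_le)
      ultimately show ?thesis
        using e(2)[of f "q f"] d(1) d(2)[of f] f by (cases "f \<in> F") (auto simp: F_def)
    qed
    moreover have "q \<in> extensional omega_units"
      using qb(1) topspace_beta_omega_subset by (auto simp: PiE_def)
    ultimately show "q \<in> U"
      using V(4) W(2) qb(3) by (auto simp: PiE_def)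
  qed
  ultimately show ?thesis
    using that by blast
qed

text \<open>A clopen set is compact, so finitely many of the traces inside it cover it, and finite
  unions of traces are traces.\<close>

lemma clopen_omega_star: "clopen_sets omega_star = range star"
proof
  show "clopen_sets omega_star \<subseteq> range star"
  proof
    fix C assume C: "C \<in> clopen_sets omega_star"
    then have "compactin omega_star C"
      by (intro closedin_compact_space compact_space_omega_star clopen_setsD)
    moreover have "C \<subseteq> \<Union>{star A | A. star A \<subseteq> C}"
    proof
      fix p assume "p \<in> C"
      then obtain A where "p \<in> star A" "star A \<subseteq> C"
        using star_base clopen_setsD(1)[OF C] by blast
      then show "p \<in> \<Union>{star A | A. star A \<subseteq> C}"
        by blast
    qed
    ultimately obtain \<F> where F: "finite \<F>" "\<F> \<subseteq> {star A | A. star A \<subseteq> C}" "C \<subseteq> \<Union>\<F>"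
      using compactinD[of omega_star C "{star A | A. star A \<subseteq> C}"] clopen_setsD(1)[OF star_clopen]
      by blast
    have gen: "\<exists>A. \<Union>\<G> = star A" if "finite \<G>" "\<G> \<subseteq> range star" for \<G>
      using that
    proof (induction rule: finite_induct)
      case empty
      then show ?case
        using star_empty_iff[of "{}"] by auto
    next
      case (insert D \<G>)
      then show ?case
        by (auto simp: star_Un[symmetric])
    qed
    have "\<F> \<subseteq> range star"
      using F(2) by auto
    from gen[OF F(1) this] have "\<exists>A. \<Union>\<F> = star A" .
    moreover have "\<Union>\<F> = C"
      using F by blast
    ultimately show "C \<in> range star"
      by blast
  qed
qed (auto simp: star_clopen)

section \<open>Stone duality for homeomorphisms\<close>

definition boolean_space :: "'a topology \<Rightarrow> bool" where
  "boolean_space X \<longleftrightarrow> compact_space X \<and> Hausdorff_space X \<and>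
     (\<forall>U x. openin X U \<and> x \<in> U \<longrightarrow> (\<exists>C\<in>clopen_sets X. x \<in> C \<and> C \<subseteq> U))"

lemma boolean_space_base:
  assumes "boolean_space X" "openin X U" "x \<in> U"
  obtains C where "C \<in> clopen_sets X" "x \<in> C" "C \<subseteq> U"
  using assms unfolding boolean_space_def by blast

lemma boolean_space_separate:
  assumes X: "boolean_space X" and "x \<in> topspace X" "y \<in> topspace X" "x \<noteq> y"
  obtains C where "C \<in> clopen_sets X" "x \<in> C" "y \<notin> C"
proof -
  have "t1_space X"
    using X by (simp add: boolean_space_def Hausdorff_imp_t1_space)
  then obtain U where "openin X U" "x \<in> U" "y \<notin> U"
    using assms unfolding t1_space_def by blast
  then show ?thesis
    using boolean_space_base[OF X] that by blast
qed

lemma boolean_space_eqI: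
  assumes "boolean_space X" "x \<in> topspace X" "y \<in> topspace X"
    and "\<And>C. C \<in> clopen_sets X \<Longrightarrow> x \<in> C \<Longrightarrow> y \<in> C"
  shows "x = y"
  using boolean_space_separate assms by metis

lemma boolean_space_omega_star: "boolean_space omega_star"
  unfolding boolean_space_def
  using compact_space_omega_star Hausdorff_space_omega_star star_base star_clopen by metis

definition clopen_hom :: "'a topology \<Rightarrow> ('a set \<Rightarrow> 'a set) \<Rightarrow> bool" where
  "clopen_hom X \<sigma> \<longleftrightarrow> \<sigma> \<in> clopen_sets X \<rightarrow> clopen_sets X \<and>
     (\<forall>U\<in>clopen_sets X. \<sigma> (topspace X - U) = topspace X - \<sigma> U) \<and>
     (\<forall>U\<in>clopen_sets X. \<forall>V\<in>clopen_sets X. \<sigma> (U \<union> V) = \<sigma> U \<union> \<sigma> V)"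

lemma clopen_homD:
  assumes "clopen_hom X \<sigma>"
  shows "U \<in> clopen_sets X \<Longrightarrow> \<sigma> U \<in> clopen_sets X"
    and "U \<in> clopen_sets X \<Longrightarrow> \<sigma> (topspace X - U) = topspace X - \<sigma> U"
    and "U \<in> clopen_sets X \<Longrightarrow> V \<in> clopen_sets X \<Longrightarrow> \<sigma> (U \<union> V) = \<sigma> U \<union> \<sigma> V"
  using assms unfolding clopen_hom_def by auto

lemma clopen_hom_Int:
  assumes \<sigma>: "clopen_hom X \<sigma>" and UV: "U \<in> clopen_sets X" "V \<in> clopen_sets X"
  shows "\<sigma> (U \<inter> V) = \<sigma> U \<inter> \<sigma> V"
proof -
  let ?c = "\<lambda>A. topspace X - A"
  have "U \<inter> V = ?c (?c U \<union> ?c V)"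
    using clopen_sets_subset UV by blast
  then have "\<sigma> (U \<inter> V) = ?c (?c (\<sigma> U) \<union> ?c (\<sigma> V))"
    using UV by (simp add: clopen_homD[OF \<sigma>] clopen_sets_closed)
  also have "\<dots> = \<sigma> U \<inter> \<sigma> V"
    using clopen_sets_subset[OF clopen_homD(1)[OF \<sigma>]] UV by blast
  finally show ?thesis .
qed

lemma clopen_hom_topspace:
  assumes \<sigma>: "clopen_hom X \<sigma>"
  shows "\<sigma> (topspace X) = topspace X"
proof -
  have "\<sigma> (topspace X) = \<sigma> {} \<union> (topspace X - \<sigma> {})"
    using clopen_homD(3)[OF \<sigma>, of "{}" "topspace X"] clopen_homD(2)[OF \<sigma>, of "{}"]
    by (simp add: clopen_sets_closed)
  then show ?thesis
    using clopen_sets_subset[OF clopen_homD(1)[OF \<sigma> clopen_sets_closed(1)]] by blast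
qed

text \<open>The images of the clopen neighbourhoods of \<open>p\<close> have the finite intersection
  property, since \<open>\<sigma>\<close> preserves meets and nonemptiness; compactness gives
  \<open>q\<close>. Applying this to the complement of \<open>U\<close> when \<open>p\<close> is
  outside \<open>U\<close> turns the implication into an equivalence.\<close>

lemma clopen_hom_point:
  assumes X: "boolean_space X" and \<sigma>: "clopen_hom X \<sigma>"
    and ne: "\<And>U. U \<in> clopen_sets X \<Longrightarrow> U \<noteq> {} \<Longrightarrow> \<sigma> U \<noteq> {}" and p: "p \<in> topspace X"
  obtains q where "q \<in> topspace X" "\<And>U. U \<in> clopen_sets X \<Longrightarrow> q \<in> \<sigma> U \<longleftrightarrow> p \<in> U"
proof -
  let ?N = "{U \<in> clopen_sets X. p \<in> U}"
  have fip: "\<Inter>\<F> \<noteq> {}" if "finite \<F>" "\<F> \<subseteq> \<sigma> ` ?N" for \<F>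
  proof -
    have "\<exists>V\<in>?N. \<sigma> V \<subseteq> \<Inter>\<F>"
      using that
    proof (induction rule: finite_induct)
      case empty
      then show ?case
        using p clopen_sets_closed(2) by auto
    next
      case (insert W \<F>)
      then obtain U V where "U \<in> ?N" "W = \<sigma> U" "V \<in> ?N" "\<sigma> V \<subseteq> \<Inter>\<F>"
        by auto
      then show ?case
        by (intro bexI[of _ "U \<inter> V"]) (auto simp: clopen_hom_Int[OF \<sigma>] clopen_sets_closed)
    qed
    then show ?thesis
      using ne by blast
  qed
  have clo: "closedin X W" if "W \<in> \<sigma> ` ?N" for W
    using that clopen_homD(1)[OF \<sigma>] clopen_setsD(2) by blast
  have "compact_space X"
    using X by (simp add: boolean_space_def)
  then have "\<Inter>(\<sigma> ` ?N) \<noteq> {}"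
    unfolding compact_space_fip by (rule allE[of _ "\<sigma> ` ?N"]) (use clo fip in blast)
  then obtain q where "q \<in> \<Inter>(\<sigma> ` ?N)"
    unfolding ex_in_conv[symmetric] ..
  then have q: "\<And>U. U \<in> ?N \<Longrightarrow> q \<in> \<sigma> U"
    by blast
  show ?thesis
  proof
    show "q \<in> topspace X"
      using q[of "topspace X"] p clopen_hom_topspace[OF \<sigma>] clopen_sets_closed(2) by auto
    show "q \<in> \<sigma> U \<longleftrightarrow> p \<in> U" if U: "U \<in> clopen_sets X" for U
      using q[of U] q[of "topspace X - U"] U p
      by (auto simp: clopen_sets_closed clopen_homD[OF \<sigma>])
  qed
qed

lemma carrier_homeo_group:
  "carrier (homeo_group X) = {f \<in> extensional (topspace X). homeomorphic_map X X f}"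
proof -
  have "bij_betw f (topspace X) (topspace X)" if "homeomorphic_map X X f" for f
    using that by (auto simp: bij_betw_def homeomorphic_eq_everything_map)
  then show ?thesis
    by (auto simp: homeo_group_def Bij_def)
qed

text \<open>Points \<open>f p\<close> and \<open>g p\<close> are obtained from
  \<open>\<sigma>\<close> and \<open>\<tau>\<close> respectively. They invert each other because
  clopen sets separate points, and the preimage of a clopen \<open>C\<close> under \<open>f\<close>
  is \<open>\<tau> C\<close>, which gives continuity. The auxiliary facts speak of a generic pair
  \<open>\<rho>\<close>, \<open>\<rho>'\<close> so as to serve both directions.\<close>

theorem clopen_automorphism_homeomorphism:
  assumes X: "boolean_space X" and \<sigma>: "clopen_hom X \<sigma>" and \<tau>: "clopen_hom X \<tau>"
    and \<tau>\<sigma>: "\<And>U. U \<in> clopen_sets X \<Longrightarrow> \<tau> (\<sigma> U) = U"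
    and \<sigma>\<tau>: "\<And>U. U \<in> clopen_sets X \<Longrightarrow> \<sigma> (\<tau> U) = U"
  obtains h where "h \<in> carrier (homeo_group X)" "\<And>U. U \<in> clopen_sets X \<Longrightarrow> h ` U = \<sigma> U"
proof -
  have inverse_ne: "\<rho> U \<noteq> {}"
    if \<rho>: "clopen_hom X \<rho>" and \<rho>': "clopen_hom X \<rho>'" and inv: "\<And>U. U \<in> clopen_sets X \<Longrightarrow> \<rho>' (\<rho> U) = U"
      and U: "U \<in> clopen_sets X" "U \<noteq> {}" for \<rho> \<rho>' U
  proof
    assume "\<rho> U = {}"
    then have "U = \<rho>' {}"
      using inv[OF U(1)] by simp
    also have "\<dots> = {}"
      using clopen_homD(2)[OF \<rho>' clopen_sets_closed(2)] clopen_hom_topspace[OF \<rho>'] by simp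
    finally show False
      using U(2) by simp
  qed
  have ex: "\<exists>f. \<forall>p\<in>topspace X. f p \<in> topspace X \<and> (\<forall>U\<in>clopen_sets X. f p \<in> \<rho> U \<longleftrightarrow> p \<in> U)"
    if \<rho>: "clopen_hom X \<rho>" and \<rho>': "clopen_hom X \<rho>'" and inv: "\<And>U. U \<in> clopen_sets X \<Longrightarrow> \<rho>' (\<rho> U) = U" for \<rho> \<rho>'
  proof (intro bchoice ballI)
    fix p assume "p \<in> topspace X"
    then show "\<exists>q. q \<in> topspace X \<and> (\<forall>U\<in>clopen_sets X. q \<in> \<rho> U \<longleftrightarrow> p \<in> U)"
      using clopen_hom_point[OF X \<rho> inverse_ne[OF \<rho> \<rho>' inv]] by metis
  qed
  obtain f where f: "\<And>p. p \<in> topspace X \<Longrightarrow> f p \<in> topspace X"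
    "\<And>p U. p \<in> topspace X \<Longrightarrow> U \<in> clopen_sets X \<Longrightarrow> f p \<in> \<sigma> U \<longleftrightarrow> p \<in> U"
    using ex[OF \<sigma> \<tau> \<tau>\<sigma>] by blast
  obtain g where g: "\<And>p. p \<in> topspace X \<Longrightarrow> g p \<in> topspace X"
    "\<And>p U. p \<in> topspace X \<Longrightarrow> U \<in> clopen_sets X \<Longrightarrow> g p \<in> \<tau> U \<longleftrightarrow> p \<in> U"
    using ex[OF \<tau> \<sigma> \<sigma>\<tau>] by blast
  have inv: "g' (f' p) = p"
    if "\<And>p. p \<in> topspace X \<Longrightarrow> f' p \<in> topspace X" "\<And>p. p \<in> topspace X \<Longrightarrow> g' p \<in> topspace X"
      "\<And>p U. p \<in> topspace X \<Longrightarrow> U \<in> clopen_sets X \<Longrightarrow> f' p \<in> \<rho> U \<longleftrightarrow> p \<in> U"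
      "\<And>p U. p \<in> topspace X \<Longrightarrow> U \<in> clopen_sets X \<Longrightarrow> g' p \<in> \<rho>' U \<longleftrightarrow> p \<in> U"
      "clopen_hom X \<rho>" "\<And>U. U \<in> clopen_sets X \<Longrightarrow> \<rho>' (\<rho> U) = U" "p \<in> topspace X" for f' g' \<rho> \<rho>' p
  proof (rule boolean_space_eqI[OF X, symmetric])
    fix C assume C: "C \<in> clopen_sets X" "p \<in> C"
    then have "g' (f' p) \<in> \<rho>' (\<rho> C)"
      using that clopen_homD(1)[OF that(5)] by blast
    then show "g' (f' p) \<in> C"
      using that(6) C by simp
  qed (use that in auto)
  have gf: "g (f p) = p" if "p \<in> topspace X" for p
    by (rule inv[of f g \<sigma> \<tau>]) (use f g \<sigma> \<tau>\<sigma> that in auto)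
  have fg: "f (g p) = p" if "p \<in> topspace X" for p
    by (rule inv[of g f \<tau> \<sigma>]) (use f g \<tau> \<sigma>\<tau> that in auto)
  have cont: "continuous_map X X f'"
    if f': "\<And>p. p \<in> topspace X \<Longrightarrow> f' p \<in> topspace X"
      "\<And>p U. p \<in> topspace X \<Longrightarrow> U \<in> clopen_sets X \<Longrightarrow> f' p \<in> \<rho> U \<longleftrightarrow> p \<in> U"
      and \<rho>': "clopen_hom X \<rho>'" and "\<And>U. U \<in> clopen_sets X \<Longrightarrow> \<rho> (\<rho>' U) = U" for f' \<rho> \<rho>'
    unfolding continuous_map_def
  proof (intro conjI allI impI)
    fix U assume U: "openin X U"
    show "openin X {x \<in> topspace X. f' x \<in> U}"
    proof (subst openin_subopen, intro ballI)
      fix p assume p: "p \<in> {x \<in> topspace X. f' x \<in> U}"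
      then obtain C where C: "C \<in> clopen_sets X" "f' p \<in> C" "C \<subseteq> U"
        using boolean_space_base[OF X U, of "f' p"] by auto
      have *: "x \<in> \<rho>' C \<longleftrightarrow> f' x \<in> C" if "x \<in> topspace X" for x
        using f'(2)[OF that clopen_homD(1)[OF \<rho>' C(1)]] \<open>\<And>U. U \<in> clopen_sets X \<Longrightarrow> \<rho> (\<rho>' U) = U\<close>[OF C(1)]
        by simp
      show "\<exists>T. openin X T \<and> p \<in> T \<and> T \<subseteq> {x \<in> topspace X. f' x \<in> U}"
        using * p C clopen_setsD(1)[OF clopen_homD(1)[OF \<rho>' C(1)]]
          clopen_sets_subset[OF clopen_homD(1)[OF \<rho>' C(1)]]
        by (intro exI[of _ "\<rho>' C"]) auto
    qed
  qed (use f' in auto)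
  have "homeomorphic_maps X X f g"
    using cont[of f \<sigma> \<tau>] cont[of g \<tau> \<sigma>] f g \<sigma> \<tau> \<sigma>\<tau> \<tau>\<sigma> gf fg by (simp add: homeomorphic_maps_def)
  then have "homeomorphic_map X X (restrict f (topspace X))"
    by (intro homeomorphic_map_eq[OF homeomorphic_maps_imp_map]) auto
  then have "restrict f (topspace X) \<in> carrier (homeo_group X)"
    by (simp add: carrier_homeo_group)
  moreover have "restrict f (topspace X) ` U = \<sigma> U" if U: "U \<in> clopen_sets X" for U
  proof -
    have "restrict f (topspace X) ` U = f ` U"
      using clopen_sets_subset[OF U] by auto
    also have "\<dots> = \<sigma> U"
    proof
      show "f ` U \<subseteq> \<sigma> U"
        using f(2) U clopen_sets_subset[OF U] by blast
      show "\<sigma> U \<subseteq> f ` U"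
      proof
        fix q assume q: "q \<in> \<sigma> U"
        then have "q \<in> topspace X"
          using clopen_sets_subset[OF clopen_homD(1)[OF \<sigma> U]] by blast
        then have "f (g q) = q" "g q \<in> U"
          using fg f(2)[OF g(1) U] q by auto
        then show "q \<in> f ` U"
          by (metis imageI)
      qed
    qed
    finally show ?thesis .
  qed
  ultimately show ?thesis
    using that by blast
qed

section \<open>The homeomorphism group with the modified topology\<close>

lemma homeo_group_subgroup:
  "subgroup {f \<in> Bij (topspace X). homeomorphic_map X X f} (BijGroup (topspace X))"
proof (rule group.subgroupI[OF group_BijGroup])
  let ?H = "{f \<in> Bij (topspace X). homeomorphic_map X X f}"
  show "?H \<subseteq> carrier (BijGroup (topspace X))"
    by (auto simp: BijGroup_def)
  have "homeomorphic_map X X (\<lambda>x\<in>topspace X. x)"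
    by (rule homeomorphic_map_eq[of X X id]) auto
  then show "?H \<noteq> {}"
    using id_Bij by blast
  fix f assume f: "f \<in> ?H"
  then obtain g where g: "homeomorphic_maps X X f g"
    by (auto simp: homeomorphic_map_maps)
  have "inv\<^bsub>BijGroup (topspace X)\<^esub> f = (\<lambda>x\<in>topspace X. inv_into (topspace X) f x)"
    using f by (simp add: inv_BijGroup)
  moreover have "homeomorphic_map X X (\<lambda>x\<in>topspace X. inv_into (topspace X) f x)"
  proof (rule homeomorphic_map_eq[of X X g])
    show "homeomorphic_map X X g"
      using g homeomorphic_maps_map by blast
    fix x assume x: "x \<in> topspace X"
    have "inj_on f (topspace X)"
      using f by (auto simp: Bij_def bij_betw_def)
    moreover have "g x \<in> topspace X" "f (g x) = x"
      using g x by (auto simp: homeomorphic_maps_def continuous_map_def)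
    ultimately show "g x = (\<lambda>x\<in>topspace X. inv_into (topspace X) f x) x"
      using x inv_into_f_eq[of f "topspace X" "g x" x] by simp
  qed
  ultimately show "inv\<^bsub>BijGroup (topspace X)\<^esub> f \<in> ?H"
    using f restrict_inv_into_Bij by auto
  fix h assume h: "h \<in> ?H"
  have "homeomorphic_map X X (f \<circ> h)"
    using f h by (intro homeomorphic_map_compose[of X X h X f]) auto
  then have "homeomorphic_map X X (compose (topspace X) f h)"
    by (rule homeomorphic_map_eq) (simp add: compose_def)
  then show "f \<otimes>\<^bsub>BijGroup (topspace X)\<^esub> h \<in> ?H"
    using f h by (simp add: BijGroup_def compose_Bij)
qed

lemma group_homeo_group: "group (homeo_group X)"
  unfolding homeo_group_def
  by (rule subgroup.subgroup_is_group[OF homeo_group_subgroup group_BijGroup])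

section \<open>The action of homeomorphisms on clopen sets\<close>

lemma homeo_group_mult:
  assumes "f \<in> carrier (homeo_group X)" "g \<in> carrier (homeo_group X)"
  shows "f \<otimes>\<^bsub>homeo_group X\<^esub> g = compose (topspace X) f g"
  using assms by (simp add: homeo_group_def BijGroup_def)

lemma homeo_group_mult_image:
  assumes "f \<in> carrier (homeo_group X)" "g \<in> carrier (homeo_group X)" "C \<subseteq> topspace X"
  shows "(f \<otimes>\<^bsub>homeo_group X\<^esub> g) ` C = f ` g ` C"
  unfolding homeo_group_mult[OF assms(1,2)]
  using assms(3) by (force simp: compose_def)

lemma homeo_group_one_image: "C \<subseteq> topspace X \<Longrightarrow> \<one>\<^bsub>homeo_group X\<^esub> ` C = C"
  by (force simp: homeo_group_def BijGroup_def)

lemma homeo_group_image_subset: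
  "f \<in> carrier (homeo_group X) \<Longrightarrow> C \<subseteq> topspace X \<Longrightarrow> f ` C \<subseteq> topspace X"
  unfolding carrier_homeo_group homeomorphic_eq_everything_map by auto

lemma homeo_group_image_inject:
  assumes "f \<in> carrier (homeo_group X)" "C \<subseteq> topspace X" "D \<subseteq> topspace X"
  shows "f ` C = f ` D \<longleftrightarrow> C = D"
proof -
  have "inj_on f (topspace X)"
    using assms(1) by (auto simp: carrier_homeo_group homeomorphic_eq_everything_map)
  then show ?thesis
    using assms(2,3) by (simp add: inj_on_image_eq_iff)
qed

lemma homeo_group_image_Diff:
  assumes "f \<in> carrier (homeo_group X)" "C \<subseteq> topspace X"
  shows "f ` (topspace X - C) = topspace X - f ` C"
proof -
  have "inj_on f (topspace X)" "f ` topspace X = topspace X"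
    using assms(1) by (auto simp: carrier_homeo_group homeomorphic_eq_everything_map)
  then show ?thesis
    using assms(2) by (metis inj_on_image_set_diff Diff_subset order_refl)
qed

lemma homeo_group_inv_image:
  assumes f: "f \<in> carrier (homeo_group X)" and C: "C \<subseteq> topspace X"
  shows "f ` (inv\<^bsub>homeo_group X\<^esub> f) ` C = C" "(inv\<^bsub>homeo_group X\<^esub> f) ` f ` C = C"
  using homeo_group_mult_image[OF f group.inv_closed[OF group_homeo_group f] C]
    homeo_group_mult_image[OF group.inv_closed[OF group_homeo_group f] f C]
  by (simp_all add: group.r_inv[OF group_homeo_group f] group.l_inv[OF group_homeo_group f]
      homeo_group_one_image[OF C])

lemma homeo_group_image_clopen:
  assumes "f \<in> carrier (homeo_group X)" "C \<in> clopen_sets X"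
  shows "f ` C \<in> clopen_sets X"
  using assms
  by (auto simp: carrier_homeo_group clopen_sets_def homeomorphic_eq_everything_map open_map_def closed_map_def)

text \<open>Clopen sets separate points. A clopen neighbourhood \<open>C\<close> of
  \<open>f x\<close> is first written as the image under \<open>f\<close> of a clopen set, since the
  assumption compares images.\<close>

lemma homeo_group_eqI:
  assumes X: "boolean_space X" and f: "f \<in> carrier (homeo_group X)" and g: "g \<in> carrier (homeo_group X)"
    and eq: "\<And>C. C \<in> clopen_sets X \<Longrightarrow> f ` C = g ` C"
  shows "f = g"
proof (rule extensionalityI[of _ "topspace X"])
  show "f \<in> extensional (topspace X)" "g \<in> extensional (topspace X)"
    using f g by (auto simp: carrier_homeo_group)
  fix x assume x: "x \<in> topspace X"
  have inv: "inv\<^bsub>homeo_group X\<^esub> f \<in> carrier (homeo_group X)"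
    by (rule group.inv_closed[OF group_homeo_group f])
  show "f x = g x"
  proof (rule boolean_space_eqI[OF X])
    show "f x \<in> topspace X" "g x \<in> topspace X"
      using homeo_group_image_subset[OF f, of "{x}"] homeo_group_image_subset[OF g, of "{x}"] x by auto
    fix C assume C: "C \<in> clopen_sets X" "f x \<in> C"
    let ?D = "(inv\<^bsub>homeo_group X\<^esub> f) ` C"
    have D: "?D \<in> clopen_sets X" "f ` ?D = C"
      using homeo_group_image_clopen[OF inv C(1)] homeo_group_inv_image(1)[OF f clopen_sets_subset[OF C(1)]]
      by auto
    have "f ` {x} \<subseteq> f ` ?D"
      using C D by simp
    moreover have "inj_on f (topspace X)"
      using f by (auto simp: carrier_homeo_group homeomorphic_eq_everything_map)
    ultimately have "x \<in> ?D"
      using inj_on_image_subset_iff[of f "topspace X" "{x}" ?D] x clopen_sets_subset[OF D(1)] by auto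
    then show "g x \<in> C"
      using eq[OF D(1)] D(2) by blast
  qed
qed

text \<open>For a homeomorphism \<open>f\<close>, the left coset by \<open>f\<close> of the
  pointwise stabilizer of \<open>\<C>\<close> in the action on sets. Such cosets with countable
  clopen \<open>\<C>\<close> turn out to be a base of the modified topology.\<close>

definition agreeing :: "'a topology \<Rightarrow> ('a \<Rightarrow> 'a) \<Rightarrow> 'a set set \<Rightarrow> ('a \<Rightarrow> 'a) set" where
  "agreeing X f \<C> = {g \<in> carrier (homeo_group X). \<forall>C\<in>\<C>. g ` C = f ` C}"

lemma agreeing_Un: "agreeing X f (\<C> \<union> \<D>) = agreeing X f \<C> \<inter> agreeing X f \<D>"
  unfolding agreeing_def by blast

lemma agreeing_antimono: "\<D> \<subseteq> \<C> \<Longrightarrow> agreeing X f \<C> \<subseteq> agreeing X f \<D>"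
  unfolding agreeing_def by blast

lemma agreeing_subset: "agreeing X f \<C> \<subseteq> carrier (homeo_group X)"
  unfolding agreeing_def by blast

lemma agreeing_self: "f \<in> carrier (homeo_group X) \<Longrightarrow> f \<in> agreeing X f \<C>"
  by (simp add: agreeing_def)

section \<open>The modified compact-open topology in terms of clopen sets\<close>

lemma topspace_compact_open_topology:
  "topspace (compact_open_topology X) = carrier (homeo_group X)"
proof -
  have "carrier (homeo_group X) = {f \<in> carrier (homeo_group X). f ` {} \<subseteq> {}}"
    by simp
  then have "carrier (homeo_group X) \<in> {{f \<in> carrier (homeo_group X). f ` K \<subseteq> U} |K U. compactin X K \<and> openin X U}"
    using compactin_empty[of X] openin_empty[of X] by blast
  then show ?thesis
    by (auto simp: compact_open_topology_def)
qed

lemma compact_open_subbase: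
  "compactin X K \<Longrightarrow> openin X U \<Longrightarrow>
     openin (compact_open_topology X) {f \<in> carrier (homeo_group X). f ` K \<subseteq> U}"
  unfolding compact_open_topology_def openin_topology_generated_by_iff
  by (rule generate_topology_on.Basis) blast

lemma openin_compact_open_agreeing_single:
  assumes X: "compact_space X" and C: "C \<in> clopen_sets X" and f: "f \<in> carrier (homeo_group X)"
  shows "openin (compact_open_topology X) (agreeing X f {C})"
proof -
  let ?H = "carrier (homeo_group X)" and ?T = "topspace X"
  have sub: "C \<subseteq> ?T"
    by (rule clopen_sets_subset[OF C])
  have C': "?T - C \<in> clopen_sets X"
    using C by (rule clopen_sets_closed)
  \<comment> \<open>For bijections, inclusion on the complement of \<open>C\<close> is the reverse
    inclusion on \<open>C\<close>; equality thus becomes two subbasic conditions.\<close>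
  have key: "g ` C = f ` C \<longleftrightarrow> g ` C \<subseteq> f ` C \<and> g ` (?T - C) \<subseteq> f ` (?T - C)" if g: "g \<in> ?H" for g
    unfolding homeo_group_image_Diff[OF g sub] homeo_group_image_Diff[OF f sub]
    using homeo_group_image_subset[OF g sub] homeo_group_image_subset[OF f sub] by blast
  have "agreeing X f {C} = {g \<in> ?H. g ` C \<subseteq> f ` C} \<inter> {g \<in> ?H. g ` (?T - C) \<subseteq> f ` (?T - C)}"
  proof (rule Set.set_eqI)
    fix g
    show "g \<in> agreeing X f {C} \<longleftrightarrow> g \<in> {g \<in> ?H. g ` C \<subseteq> f ` C} \<inter> {g \<in> ?H. g ` (?T - C) \<subseteq> f ` (?T - C)}"
      by (cases "g \<in> ?H") (simp_all add: agreeing_def key)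
  qed
  moreover have "openin (compact_open_topology X) {g \<in> ?H. g ` D \<subseteq> f ` D}" if "D \<in> clopen_sets X" for D
    using that homeo_group_image_clopen[OF f that]
    by (intro compact_open_subbase closedin_compact_space[OF X]) (auto simp: clopen_sets_def)
  ultimately show ?thesis
    using C C' by auto
qed

lemma openin_Gdelta_compact_open_iff:
  assumes X: "boolean_space X"
  shows "openin (Gdelta_modification (compact_open_topology X)) W \<longleftrightarrow>
    W \<subseteq> carrier (homeo_group X) \<and>
    (\<forall>f\<in>W. \<exists>\<C>. countable \<C> \<and> \<C> \<subseteq> clopen_sets X \<and> agreeing X f \<C> \<subseteq> W)"
    (is "?L W \<longleftrightarrow> ?R W")
proof
  have cpt: "compact_space X"
    using X by (simp add: boolean_space_def)
  have top: "istopology ?R"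
    unfolding istopology_def
  proof (rule conjI; intro allI impI)
    fix S T assume ST: "?R S" "?R T"
    show "?R (S \<inter> T)"
    proof (intro conjI ballI)
      fix f assume "f \<in> S \<inter> T"
      then obtain \<C> \<D> where "countable \<C>" "\<C> \<subseteq> clopen_sets X" "agreeing X f \<C> \<subseteq> S"
        "countable \<D>" "\<D> \<subseteq> clopen_sets X" "agreeing X f \<D> \<subseteq> T"
        using ST by (metis IntE)
      then show "\<exists>\<C>. countable \<C> \<and> \<C> \<subseteq> clopen_sets X \<and> agreeing X f \<C> \<subseteq> S \<inter> T"
        by (intro exI[of _ "\<C> \<union> \<D>"]) (auto simp: agreeing_Un)
    qed (use ST in auto)
  next
    fix \<K> assume "\<forall>K\<in>\<K>. ?R K"
    then show "?R (\<Union>\<K>)"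
      by (meson Union_iff Sup_least Sup_upper subset_trans)
  qed
  have co: "?R W" if "openin (compact_open_topology X) W" for W
  proof (rule generate_topology_on_coarsest[OF top])
    show "generate_topology_on {{f \<in> carrier (homeo_group X). f ` K \<subseteq> U} |K U. compactin X K \<and> openin X U} W"
      using that by (simp add: compact_open_topology_def openin_topology_generated_by_iff)
    fix S assume "S \<in> {{f \<in> carrier (homeo_group X). f ` K \<subseteq> U} |K U. compactin X K \<and> openin X U}"
    then obtain K U where S: "S = {f \<in> carrier (homeo_group X). f ` K \<subseteq> U}" "compactin X K" "openin X U"
      by blast
    show "?R S"
    proof (intro conjI ballI)
      fix f assume "f \<in> S"
      then have f: "f \<in> carrier (homeo_group X)" "f ` K \<subseteq> U"
        by (auto simp: S)
      then have "compactin X (f ` K)"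
        using S(2) image_compactin by (fastforce simp: carrier_homeo_group homeomorphic_eq_everything_map)
      let ?\<U> = "{C \<in> clopen_sets X. C \<subseteq> U}"
      have "f ` K \<subseteq> \<Union>?\<U>"
        using f(2) boolean_space_base[OF X S(3)] by blast
      then have "\<exists>\<F>. finite \<F> \<and> \<F> \<subseteq> ?\<U> \<and> f ` K \<subseteq> \<Union>\<F>"
        by (intro compactinD[OF \<open>compactin X (f ` K)\<close>]) (auto dest: clopen_setsD(1))
      then obtain \<F> where F: "finite \<F>" "\<F> \<subseteq> ?\<U>" "f ` K \<subseteq> \<Union>\<F>"
        by blast
      have "\<Union>\<F> \<in> clopen_sets X"
        using F(1,2) by (auto simp: clopen_sets_def intro: closedin_Union)
      then have D: "(inv\<^bsub>homeo_group X\<^esub> f) ` \<Union>\<F> \<in> clopen_sets X" "f ` (inv\<^bsub>homeo_group X\<^esub> f) ` \<Union>\<F> = \<Union>\<F>"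
        by (simp_all add: homeo_group_image_clopen group.inv_closed[OF group_homeo_group] f
            homeo_group_inv_image clopen_sets_subset)
      have "K \<subseteq> topspace X"
        using S(2) compactin_subset_topspace by blast
      then have "K = (inv\<^bsub>homeo_group X\<^esub> f) ` f ` K"
        using homeo_group_inv_image(2)[OF f(1)] by simp
      also have "\<dots> \<subseteq> (inv\<^bsub>homeo_group X\<^esub> f) ` \<Union>\<F>"
        by (rule image_mono[OF F(3)])
      finally have K: "K \<subseteq> (inv\<^bsub>homeo_group X\<^esub> f) ` \<Union>\<F>" .
      have sub: "g ` K \<subseteq> U" if "g ` (inv\<^bsub>homeo_group X\<^esub> f) ` \<Union>\<F> = f ` (inv\<^bsub>homeo_group X\<^esub> f) ` \<Union>\<F>" for g
        using image_mono[OF K, of g] F(2) unfolding that D(2) by blast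
      have "agreeing X f {(inv\<^bsub>homeo_group X\<^esub> f) ` \<Union>\<F>} \<subseteq> S"
      proof
        fix g assume "g \<in> agreeing X f {(inv\<^bsub>homeo_group X\<^esub> f) ` \<Union>\<F>}"
        then have "g \<in> carrier (homeo_group X)"
          "g ` (inv\<^bsub>homeo_group X\<^esub> f) ` \<Union>\<F> = f ` (inv\<^bsub>homeo_group X\<^esub> f) ` \<Union>\<F>"
          unfolding agreeing_def by simp_all
        then show "g \<in> S"
          using sub by (simp add: S(1))
      qed
      then show "\<exists>\<C>. countable \<C> \<and> \<C> \<subseteq> clopen_sets X \<and> agreeing X f \<C> \<subseteq> S"
        using D(1) by (intro exI[of _ "{(inv\<^bsub>homeo_group X\<^esub> f) ` \<Union>\<F>}"]) auto
    qed (auto simp: S)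
  qed
  \<comment> \<open>The intersection with the carrier covers the empty family, for which
    \<open>\<Inter>\<U>\<close> is the whole type.\<close>
  have Inter: "?R (\<Inter>\<U> \<inter> carrier (homeo_group X))" if cU: "countable \<U>" and U: "\<And>U. U \<in> \<U> \<Longrightarrow> ?R U" for \<U>
  proof (intro conjI ballI)
    fix f assume f: "f \<in> \<Inter>\<U> \<inter> carrier (homeo_group X)"
    then have "\<forall>U\<in>\<U>. \<exists>\<C>. countable \<C> \<and> \<C> \<subseteq> clopen_sets X \<and> agreeing X f \<C> \<subseteq> U"
      using U by blast
    then obtain c where c: "\<And>U. U \<in> \<U> \<Longrightarrow> countable (c U) \<and> c U \<subseteq> clopen_sets X \<and> agreeing X f (c U) \<subseteq> U"
      by metis
    show "\<exists>\<C>. countable \<C> \<and> \<C> \<subseteq> clopen_sets X \<and> agreeing X f \<C> \<subseteq> \<Inter>\<U> \<inter> carrier (homeo_group X)"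
    proof (intro exI conjI)
      show "countable (\<Union>(c ` \<U>))" "\<Union>(c ` \<U>) \<subseteq> clopen_sets X"
        using c cU by auto
      show "agreeing X f (\<Union>(c ` \<U>)) \<subseteq> \<Inter>\<U> \<inter> carrier (homeo_group X)"
      proof (intro Int_greatest Inter_greatest agreeing_subset)
        fix U assume "U \<in> \<U>"
        then show "agreeing X f (\<Union>(c ` \<U>)) \<subseteq> U"
          using c[of U] agreeing_antimono[of "c U" "\<Union>(c ` \<U>)" X f] by blast
      qed
    qed
  qed auto
  have gd: "?R W" if gd: "gdelta_in (compact_open_topology X) W" for W
  proof -
    obtain \<U> where \<U>: "countable \<U>" "\<U> \<subseteq> Collect (openin (compact_open_topology X))" "\<Inter>\<U> = W"
      and W: "W \<subseteq> carrier (homeo_group X)"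
      using gd unfolding gdelta_in_alt intersection_of_def topspace_compact_open_topology by auto
    then have eq: "\<Inter>\<U> \<inter> carrier (homeo_group X) = W"
      by blast
    have "?R U" if "U \<in> \<U>" for U
      by (rule co) (use that \<U>(2) in blast)
    from Inter[OF \<U>(1) this] show ?thesis
      unfolding eq .
  qed
  {
    assume "?L W"
    then obtain \<U> where \<U>: "\<U> \<subseteq> Collect (gdelta_in (compact_open_topology X))" and W: "\<Union>\<U> = W"
      unfolding openin_Gdelta_modification union_of_def by blast
    have "\<forall>U\<in>\<U>. ?R U"
      by (intro ballI gd) (use \<U> in blast)
    from mp[OF spec[OF conjunct2[OF top[unfolded istopology_def]]] this] show "?R W"
      unfolding W .
  next
    assume W: "?R W"
    have gd': "gdelta_in (compact_open_topology X) (agreeing X f \<C>)"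
      if "f \<in> W" "countable \<C>" "\<C> \<subseteq> clopen_sets X" for f \<C>
    proof -
      have f: "f \<in> carrier (homeo_group X)"
        using W that(1) by blast
      have eq: "agreeing X f \<C> = \<Inter>(insert (carrier (homeo_group X)) ((\<lambda>C. agreeing X f {C}) ` \<C>))"
        by (auto simp: agreeing_def)
      have "gdelta_in (compact_open_topology X) (carrier (homeo_group X))"
        using gdelta_in_topspace[of "compact_open_topology X"] by (simp add: topspace_compact_open_topology)
      moreover have "gdelta_in (compact_open_topology X) (agreeing X f {C})" if "C \<in> \<C>" for C
        using openin_compact_open_agreeing_single[OF cpt _ f] that \<open>\<C> \<subseteq> clopen_sets X\<close>
        by (intro open_imp_gdelta_in) blast
      ultimately show ?thesis
        unfolding eq using that(2) by (intro gdelta_in_Inter) auto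
    qed
    have self: "f \<in> agreeing X f \<C>" if "f \<in> W" for f \<C>
      using that W by (auto simp: agreeing_def)
    show "?L W"
      unfolding openin_Gdelta_modification union_of_def
    proof (intro exI conjI)
      let ?\<U> = "{V. gdelta_in (compact_open_topology X) V \<and> V \<subseteq> W}"
      show "?\<U> \<subseteq> Collect (gdelta_in (compact_open_topology X))"
        by blast
      show "\<Union>?\<U> = W"
      proof
        show "W \<subseteq> \<Union>?\<U>"
        proof
          fix f assume f: "f \<in> W"
          then obtain \<C> where "countable \<C>" "\<C> \<subseteq> clopen_sets X" "agreeing X f \<C> \<subseteq> W"
            using W by blast
          then show "f \<in> \<Union>?\<U>"
            using gd'[OF f] self[OF f] by blast
        qed
      qed blast
    qed (simp add: arbitrary_def)
  }
qed

abbreviation homeo_delta :: "'a topology \<Rightarrow> ('a \<Rightarrow> 'a) topology" where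
  "homeo_delta X \<equiv> Gdelta_modification (compact_open_topology X)"

lemma homeo_deltaD:
  assumes X: "boolean_space X" and W: "openin (homeo_delta X) W" and f: "f \<in> W"
  obtains \<C> where "countable \<C>" "\<C> \<subseteq> clopen_sets X" "agreeing X f \<C> \<subseteq> W"
  using conjunct2[OF iffD1[OF openin_Gdelta_compact_open_iff[OF X] W]] f by blast

lemma openin_homeo_delta_subset:
  "boolean_space X \<Longrightarrow> openin (homeo_delta X) W \<Longrightarrow> W \<subseteq> carrier (homeo_group X)"
  by (simp add: openin_Gdelta_compact_open_iff)

lemma agreeing_eq: "g \<in> agreeing X f \<C> \<Longrightarrow> agreeing X g \<C> = agreeing X f \<C>"
  unfolding agreeing_def by simp

lemma openin_agreeing:
  assumes "boolean_space X" "countable \<C>" "\<C> \<subseteq> clopen_sets X"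
  shows "openin (homeo_delta X) (agreeing X f \<C>)"
  unfolding openin_Gdelta_compact_open_iff[OF assms(1)]
proof (intro conjI ballI agreeing_subset)
  fix g assume "g \<in> agreeing X f \<C>"
  then have "agreeing X g \<C> \<subseteq> agreeing X f \<C>"
    by (simp add: agreeing_eq)
  then show "\<exists>\<D>. countable \<D> \<and> \<D> \<subseteq> clopen_sets X \<and> agreeing X g \<D> \<subseteq> agreeing X f \<C>"
    using assms(2,3) by blast
qed

lemma topspace_homeo_delta:
  assumes "boolean_space X"
  shows "topspace (homeo_delta X) = carrier (homeo_group X)"
proof
  show "topspace (homeo_delta X) \<subseteq> carrier (homeo_group X)"
    by (rule openin_homeo_delta_subset[OF assms openin_topspace])
  have "agreeing X undefined {} = carrier (homeo_group X)"
    by (simp add: agreeing_def)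
  then show "carrier (homeo_group X) \<subseteq> topspace (homeo_delta X)"
    using openin_subset[OF openin_agreeing[OF assms, of "{}" undefined]] by simp
qed

text \<open>The cosets of one stabilizer partition the group, so the complement of a coset is a
  union of open cosets.\<close>

lemma agreeing_clopen:
  assumes X: "boolean_space X" and \<C>: "countable \<C>" "\<C> \<subseteq> clopen_sets X"
  shows "agreeing X f \<C> \<in> clopen_sets (homeo_delta X)"
proof -
  have "openin (homeo_delta X) (topspace (homeo_delta X) - agreeing X f \<C>)"
    unfolding openin_Gdelta_compact_open_iff[OF X] topspace_homeo_delta[OF X]
  proof (intro conjI ballI)
    fix g assume g: "g \<in> carrier (homeo_group X) - agreeing X f \<C>"
    then have "agreeing X g \<C> \<subseteq> carrier (homeo_group X) - agreeing X f \<C>"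
      unfolding agreeing_def by auto
    then show "\<exists>\<D>. countable \<D> \<and> \<D> \<subseteq> clopen_sets X \<and>
        agreeing X g \<D> \<subseteq> carrier (homeo_group X) - agreeing X f \<C>"
      using \<C> by blast
  qed blast
  moreover have "openin (homeo_delta X) (agreeing X f \<C>)"
    by (rule openin_agreeing[OF assms])
  ultimately show ?thesis
    unfolding clopen_sets_def closedin_def mem_Collect_eq using openin_subset by iprover
qed

section \<open>The modified homeomorphism group as a P-group\<close>

lemma completely_regular_space_if_clopen_base:
  assumes "\<And>U x. openin X U \<Longrightarrow> x \<in> U \<Longrightarrow> \<exists>C\<in>clopen_sets X. x \<in> C \<and> C \<subseteq> U"
  shows "completely_regular_space X"
  unfolding completely_regular_space_alt
proof (intro allI impI)
  fix S x assume "closedin X S" "x \<in> topspace X - S"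
  then obtain C where C: "C \<in> clopen_sets X" "x \<in> C" "C \<subseteq> topspace X - S"
    using assms[of "topspace X - S" x] by blast
  define f where "f y = (if y \<in> C then 0 else 1 :: real)" for y
  have "continuous_map X euclideanreal f"
    unfolding continuous_map_def
  proof (intro conjI allI impI)
    fix U :: "real set"
    have "{y \<in> topspace X. f y \<in> U} =
        (if 0 \<in> U then C else {}) \<union> (if 1 \<in> U then topspace X - C else {})"
      using clopen_sets_subset[OF C(1)] by (auto simp: f_def)
    then show "openin X {y \<in> topspace X. f y \<in> U}"
      using C(1) clopen_sets_closed(3)[OF C(1)] by (auto simp: clopen_sets_def)
  qed simp
  moreover have "f x = 0" "f ` S \<subseteq> {1}"
    using C by (auto simp: f_def)
  ultimately show "\<exists>f. continuous_map X euclideanreal f \<and> f x = 0 \<and> f ` S \<subseteq> {1}"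
    by blast
qed

lemma tychonoff_homeo_delta:
  assumes X: "boolean_space X"
  shows "tychonoff_space (homeo_delta X)"
  unfolding tychonoff_space_def
proof
  show "t1_space (homeo_delta X)"
    unfolding t1_space_def topspace_homeo_delta[OF X]
  proof (intro ballI impI)
    fix f g assume fg: "f \<in> carrier (homeo_group X)" "g \<in> carrier (homeo_group X)" "f \<noteq> g"
    have "\<exists>C. C \<in> clopen_sets X \<and> f ` C \<noteq> g ` C"
    proof (rule ccontr)
      assume "\<nexists>C. C \<in> clopen_sets X \<and> f ` C \<noteq> g ` C"
      then have "f = g"
        by (intro homeo_group_eqI[OF X fg(1,2)]) simp
      with fg(3) show False ..
    qed
    then obtain C where C: "C \<in> clopen_sets X" "f ` C \<noteq> g ` C"
      by iprover
    have "g \<notin> agreeing X f {C}"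
      using C(2) unfolding agreeing_def by auto
    moreover have "openin (homeo_delta X) (agreeing X f {C})"
      using C(1) by (intro openin_agreeing[OF X]) auto
    ultimately show "\<exists>U. openin (homeo_delta X) U \<and> f \<in> U \<and> g \<notin> U"
      using agreeing_self[OF fg(1)] by blast
  qed
  show "completely_regular_space (homeo_delta X)"
  proof (rule completely_regular_space_if_clopen_base)
    fix U f assume U: "openin (homeo_delta X) U" "f \<in> U"
    obtain \<C> where \<C>: "countable \<C>" "\<C> \<subseteq> clopen_sets X" "agreeing X f \<C> \<subseteq> U"
      by (rule homeo_deltaD[OF X U])
    moreover have "f \<in> agreeing X f \<C>"
      using agreeing_self openin_homeo_delta_subset[OF X U(1)] U(2) by blast
    ultimately show "\<exists>C\<in>clopen_sets (homeo_delta X). f \<in> C \<and> C \<subseteq> U"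
      using agreeing_clopen[OF X \<C>(1,2)] by blast
  qed
qed

lemma homeo_delta_mult_continuous:
  assumes X: "boolean_space X"
  shows "continuous_map (prod_topology (homeo_delta X) (homeo_delta X)) (homeo_delta X)
    (\<lambda>(f, g). f \<otimes>\<^bsub>homeo_group X\<^esub> g)"
  unfolding continuous_map_def topspace_prod_topology topspace_homeo_delta[OF X]
proof (intro conjI allI impI)
  let ?H = "carrier (homeo_group X)"
  interpret group "homeo_group X"
    by (rule group_homeo_group)
  show "(\<lambda>(f, g). f \<otimes>\<^bsub>homeo_group X\<^esub> g) \<in> ?H \<times> ?H \<rightarrow> ?H"
    by auto
  fix W assume W: "openin (homeo_delta X) W"
  show "openin (prod_topology (homeo_delta X) (homeo_delta X))
      {p \<in> ?H \<times> ?H. (case p of (f, g) \<Rightarrow> f \<otimes>\<^bsub>homeo_group X\<^esub> g) \<in> W}"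
    unfolding openin_prod_topology_alt
  proof (intro allI impI)
    fix f g assume "(f, g) \<in> {p \<in> ?H \<times> ?H. (case p of (f, g) \<Rightarrow> f \<otimes>\<^bsub>homeo_group X\<^esub> g) \<in> W}"
    then have fg: "f \<in> ?H" "g \<in> ?H" and "f \<otimes>\<^bsub>homeo_group X\<^esub> g \<in> W"
      by auto
    then obtain \<C> where \<C>: "countable \<C>" "\<C> \<subseteq> clopen_sets X" "agreeing X (f \<otimes>\<^bsub>homeo_group X\<^esub> g) \<C> \<subseteq> W"
      using homeo_deltaD[OF X W] by blast
    let ?\<D> = "(\<lambda>C. g ` C) ` \<C>"
    have "?\<D> \<subseteq> clopen_sets X"
      using homeo_group_image_clopen[OF fg(2)] \<C>(2) by blast
    then have "openin (homeo_delta X) (agreeing X f ?\<D>)" "openin (homeo_delta X) (agreeing X g \<C>)"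
      using \<C> by (auto intro: openin_agreeing[OF X])
    moreover have "f' \<otimes>\<^bsub>homeo_group X\<^esub> g' \<in> W"
      if f': "f' \<in> agreeing X f ?\<D>" and g': "g' \<in> agreeing X g \<C>" for f' g'
    proof -
      have H: "f' \<in> ?H" "g' \<in> ?H"
        using f' g' agreeing_subset by blast+
      have "(f' \<otimes>\<^bsub>homeo_group X\<^esub> g') ` C = (f \<otimes>\<^bsub>homeo_group X\<^esub> g) ` C" if C: "C \<in> \<C>" for C
      proof -
        have sub: "C \<subseteq> topspace X"
          using C \<C>(2) clopen_sets_subset by blast
        have "g' ` C = g ` C" "f' ` g ` C = f ` g ` C"
          using f' g' C by (simp_all add: agreeing_def)
        then show ?thesis
          by (simp only: homeo_group_mult_image[OF H sub] homeo_group_mult_image[OF fg sub])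
      qed
      then have "f' \<otimes>\<^bsub>homeo_group X\<^esub> g' \<in> agreeing X (f \<otimes>\<^bsub>homeo_group X\<^esub> g) \<C>"
        using m_closed[OF H] by (simp add: agreeing_def)
      then show ?thesis
        using \<C>(3) by blast
    qed
    moreover have "f \<in> agreeing X f ?\<D>" "g \<in> agreeing X g \<C>"
      using agreeing_self fg by blast+
    ultimately show "\<exists>U V. openin (homeo_delta X) U \<and> openin (homeo_delta X) V \<and> f \<in> U \<and> g \<in> V \<and>
        U \<times> V \<subseteq> {p \<in> ?H \<times> ?H. (case p of (f, g) \<Rightarrow> f \<otimes>\<^bsub>homeo_group X\<^esub> g) \<in> W}"
      using agreeing_subset
      by (intro exI[of _ "agreeing X f ?\<D>"] exI[of _ "agreeing X g \<C>"]) (fast intro: subsetD[OF agreeing_subset])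
  qed
qed

lemma homeo_delta_inv_continuous:
  assumes X: "boolean_space X"
  shows "continuous_map (homeo_delta X) (homeo_delta X) (\<lambda>f. inv\<^bsub>homeo_group X\<^esub> f)"
  unfolding continuous_map_def topspace_homeo_delta[OF X]
proof (intro conjI allI impI)
  let ?H = "carrier (homeo_group X)" and ?inv = "\<lambda>f. inv\<^bsub>homeo_group X\<^esub> f"
  interpret group "homeo_group X"
    by (rule group_homeo_group)
  show "?inv \<in> ?H \<rightarrow> ?H"
    by auto
  fix W assume W: "openin (homeo_delta X) W"
  show "openin (homeo_delta X) {f \<in> ?H. ?inv f \<in> W}"
    unfolding openin_Gdelta_compact_open_iff[OF X]
  proof (intro conjI ballI)
    fix f assume "f \<in> {f \<in> ?H. ?inv f \<in> W}"
    then have f: "f \<in> ?H" "?inv f \<in> W"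
      by auto
    then obtain \<C> where \<C>: "countable \<C>" "\<C> \<subseteq> clopen_sets X" "agreeing X (?inv f) \<C> \<subseteq> W"
      using homeo_deltaD[OF X W] by blast
    \<comment> \<open>The map \<open>f\<close> sends the preimage of \<open>C\<close> to
      \<open>C\<close>; a map \<open>g\<close> doing the same has an inverse that sends
      \<open>C\<close> back to that preimage.\<close>
    let ?\<D> = "(\<lambda>C. ?inv f ` C) ` \<C>"
    have "?\<D> \<subseteq> clopen_sets X"
      using homeo_group_image_clopen[OF inv_closed[OF f(1)]] \<C>(2) by blast
    moreover have "agreeing X f ?\<D> \<subseteq> {f \<in> ?H. ?inv f \<in> W}"
    proof
      fix g assume g: "g \<in> agreeing X f ?\<D>"
      then have gH: "g \<in> ?H"
        using agreeing_subset by blast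
      have "?inv g ` C = ?inv f ` C" if C: "C \<in> \<C>" for C
      proof -
        have sub: "C \<subseteq> topspace X"
          using C \<C>(2) clopen_sets_subset by blast
        have sub': "?inv f ` C \<subseteq> topspace X"
          by (rule homeo_group_image_subset[OF inv_closed[OF f(1)] sub])
        have "g ` ?inv f ` C = f ` ?inv f ` C"
          using g C by (simp add: agreeing_def)
        then have "g ` ?inv f ` C = C"
          by (simp only: homeo_group_inv_image(1)[OF f(1) sub])
        then show ?thesis
          using homeo_group_inv_image(2)[OF gH sub'] by simp
      qed
      then have "?inv g \<in> agreeing X (?inv f) \<C>"
        using inv_closed[OF gH] by (simp add: agreeing_def)
      then show "g \<in> {f \<in> ?H. ?inv f \<in> W}"
        using \<C>(3) gH by blast
    qed
    ultimately show "\<exists>\<D>. countable \<D> \<and> \<D> \<subseteq> clopen_sets X \<and> agreeing X f \<D> \<subseteq> {f \<in> ?H. ?inv f \<in> W}"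
      using \<C>(1) by (intro exI[of _ ?\<D>]) auto
  qed auto
qed

lemma P_space_homeo_delta:
  assumes X: "boolean_space X"
  shows "P_space (homeo_delta X)"
  unfolding P_space_def
proof (intro allI impI)
  fix S assume "gdelta_in (homeo_delta X) S"
  then obtain \<U> where \<U>: "countable \<U>" "\<U> \<subseteq> Collect (openin (homeo_delta X))" "\<Inter>\<U> = S"
    and S: "S \<subseteq> carrier (homeo_group X)"
    unfolding gdelta_in_alt intersection_of_def topspace_homeo_delta[OF X] by blast
  show "openin (homeo_delta X) S"
    unfolding openin_Gdelta_compact_open_iff[OF X]
  proof (intro conjI ballI S)
    fix f assume f: "f \<in> S"
    have "\<exists>\<C>. countable \<C> \<and> \<C> \<subseteq> clopen_sets X \<and> agreeing X f \<C> \<subseteq> U" if "U \<in> \<U>" for U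
    proof -
      have "openin (homeo_delta X) U" "f \<in> U"
        using that \<U> f by auto
      then show ?thesis
        using homeo_deltaD[OF X] by metis
    qed
    then obtain c where c: "\<And>U. U \<in> \<U> \<Longrightarrow> countable (c U) \<and> c U \<subseteq> clopen_sets X \<and> agreeing X f (c U) \<subseteq> U"
      by metis
    have "agreeing X f (\<Union>(c ` \<U>)) \<subseteq> \<Inter>\<U>"
    proof (rule Inter_greatest)
      fix U assume "U \<in> \<U>"
      then show "agreeing X f (\<Union>(c ` \<U>)) \<subseteq> U"
        using c[of U] agreeing_antimono[of "c U" "\<Union>(c ` \<U>)" X f] by blast
    qed
    moreover have "countable (\<Union>(c ` \<U>))"
      using c by (intro countable_UN \<U>(1)) blast
    moreover have "\<Union>(c ` \<U>) \<subseteq> clopen_sets X"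
      using c by blast
    ultimately show "\<exists>\<C>. countable \<C> \<and> \<C> \<subseteq> clopen_sets X \<and> agreeing X f \<C> \<subseteq> S"
      unfolding \<U>(3) by blast
  qed
qed

theorem P_group_homeo_delta:
  assumes "boolean_space X"
  shows "P_group (homeo_group X) (homeo_delta X)"
  unfolding P_group_def topological_group_def
  using assms by (simp add: group_homeo_group topspace_homeo_delta tychonoff_homeo_delta
      homeo_delta_mult_continuous homeo_delta_inv_continuous P_space_homeo_delta)

section \<open>Cardinalities\<close>

lemma continuum_ordIso: "continuum =o |UNIV :: nat set set|"
proof -
  have "continuum = |Func (UNIV :: nat set) (UNIV :: bool set)|"
    by (simp add: cexp_def ctwo_def Field_natLeq Field_card_of)
  also have "|Func (UNIV :: nat set) (UNIV :: bool set)| =o |UNIV :: nat set set|"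
  proof (rule card_of_ordIsoI)
    show "bij_betw (\<lambda>f. {n. f n}) (Func (UNIV :: nat set) (UNIV :: bool set)) UNIV"
      by (rule bij_betwI[where g = "\<lambda>A n. n \<in> A"]) (auto simp: Func_def)
  qed
  finally show ?thesis .
qed

lemma card_le_continuumI:
  fixes f :: "'b \<Rightarrow> 'a" and A :: "'a set"
  assumes "A \<subseteq> range f" "|UNIV :: 'b set| \<le>o |UNIV :: nat set set|"
  shows "|A| \<le>o continuum"
proof -
  have "|A| \<le>o |range f|"
    by (rule card_of_mono1[OF assms(1)])
  also have "|range f| \<le>o |UNIV :: 'b set|"
    by (rule card_of_image)
  also have "|UNIV :: 'b set| \<le>o |UNIV :: nat set set|"
    by (rule assms(2))
  also have "|UNIV :: nat set set| =o continuum"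
    by (rule ordIso_symmetric[OF continuum_ordIso])
  finally show ?thesis .
qed

lemma card_nat_fun_le:
  fixes e :: "'a \<Rightarrow> nat set"
  assumes "inj e"
  shows "|UNIV :: (nat \<Rightarrow> 'a) set| \<le>o |UNIV :: nat set set|"
proof (rule iffD1[OF card_of_ordLeq])
  have "inj (\<lambda>v :: nat \<Rightarrow> 'a. {p. snd (prod_decode p) \<in> e (v (fst (prod_decode p)))})"
  proof (rule injI)
    fix v w :: "nat \<Rightarrow> 'a"
    assume eq: "{p. snd (prod_decode p) \<in> e (v (fst (prod_decode p)))} = {p. snd (prod_decode p) \<in> e (w (fst (prod_decode p)))}"
    have "m \<in> e (v n) \<longleftrightarrow> m \<in> e (w n)" for n m
      using eq[THEN eqset_imp_iff, of "prod_encode (n, m)"] by simp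
    then have "e (v n) = e (w n)" for n
      by blast
    then show "v = w"
      using assms by (auto simp: inj_def)
  qed
  then show "\<exists>f. inj_on f (UNIV :: (nat \<Rightarrow> 'a) set) \<and> f ` UNIV \<subseteq> (UNIV :: nat set set)"
    by blast
qed

text \<open>A basic set is prescribed by countably many clopen sets and their images, hence by one
  sequence of subsets of omega: even entries name the arguments, odd ones the images. There are only
  continuum many such sequences.\<close>

lemma weight_homeo_delta_omega_star: "weight (homeo_delta omega_star) \<le>o continuum"
proof -
  define M where "M v = {g \<in> carrier (homeo_group omega_star). \<forall>i :: nat. g ` star (v (2 * i)) = star (v (2 * i + 1))}"
    for v
  note X = boolean_space_omega_star
  have "base_of (homeo_delta omega_star) (range M)"
    unfolding base_of_def
  proof (intro conjI ballI allI impI)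
    fix V assume "V \<in> range M"
    then obtain v where v: "V = M v"
      by blast
    show "openin (homeo_delta omega_star) V"
      unfolding openin_Gdelta_compact_open_iff[OF X]
    proof (intro conjI ballI)
      fix f assume f: "f \<in> V"
      have "agreeing omega_star f (range (\<lambda>i. star (v (2 * i)))) \<subseteq> V"
        using f unfolding agreeing_def v M_def by auto
      then show "\<exists>\<C>. countable \<C> \<and> \<C> \<subseteq> clopen_sets omega_star \<and> agreeing omega_star f \<C> \<subseteq> V"
        by (intro exI[of _ "range (\<lambda>i. star (v (2 * i)))"]) (auto simp: star_clopen)
    qed (auto simp: v M_def)
  next
    fix U f assume "openin (homeo_delta omega_star) U \<and> f \<in> U"
    then have U: "openin (homeo_delta omega_star) U" "f \<in> U"
      by auto
    obtain \<C> where \<C>: "countable \<C>" "\<C> \<subseteq> clopen_sets omega_star" "agreeing omega_star f \<C> \<subseteq> U"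
      by (rule homeo_deltaD[OF X U])
    have f: "f \<in> carrier (homeo_group omega_star)"
      using openin_homeo_delta_subset[OF X U(1)] U(2) by blast
    \<comment> \<open>Inserting \<open>{}\<close> makes the family nonempty, so that it can be
      enumerated; every map preserves \<open>{}\<close>, so no new condition arises.\<close>
    define c where "c = from_nat_into (insert {} \<C>)"
    have "range c = insert {} \<C>"
      unfolding c_def by (rule range_from_nat_into) (use \<C>(1) in auto)
    then have sub: "\<C> \<subseteq> range c" and "range c \<subseteq> clopen_sets omega_star"
      using \<C>(2) clopen_sets_closed(1)[of omega_star] by auto
    then have c: "c i \<in> clopen_sets omega_star" for i
      by auto
    have "\<exists>A. c i = star A" "\<exists>B. f ` c i = star B" for i
      using c[of i] homeo_group_image_clopen[OF f c[of i]] unfolding clopen_omega_star by auto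
    then obtain a b where ab: "\<And>i. c i = star (a i)" "\<And>i. f ` c i = star (b i)"
      by metis
    define v where "v n = (if even n then a (n div 2) else b (n div 2))" for n
    have M: "M v = {g \<in> carrier (homeo_group omega_star). \<forall>i. g ` c i = f ` c i}"
      by (simp add: M_def v_def ab[symmetric])
    then have "f \<in> M v"
      using f by simp
    moreover have "M v \<subseteq> agreeing omega_star f \<C>"
    proof
      fix g assume g: "g \<in> M v"
      have "g ` C = f ` C" if "C \<in> \<C>" for C
      proof -
        have "C \<in> range c"
          using that sub by blast
        then obtain i where "C = c i"
          by blast
        then show ?thesis
          using g by (simp add: M)
      qed
      then show "g \<in> agreeing omega_star f \<C>"
        using g by (simp add: M agreeing_def)
    qed
    ultimately show "\<exists>V\<in>range M. f \<in> V \<and> V \<subseteq> U"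
      using \<C>(3) by blast
  qed
  then have "weight (homeo_delta omega_star) \<le>o |range M|"
    by (rule weight_minimal_base(2))
  also have "|range M| \<le>o continuum"
    by (rule card_le_continuumI[OF subset_refl card_nat_fun_le[of id]]) simp
  finally show ?thesis .
qed

section \<open>An action of a symmetric group on the remainder\<close>

definition fin_cofin :: "'a set set" where
  "fin_cofin = {A. finite A \<or> finite (- A)}"

text \<open>Representatives of the reduced power \<open>A\<^sup>\<omega>/fin\<close> of the finite-cofinite algebra \<open>A\<close>.\<close>

definition power_algebra :: "(nat \<times> 'a) set set" where
  "power_algebra = {a. \<forall>n. {t. (n, t) \<in> a} \<in> fin_cofin}"

lemma fin_cofin_Compl: "A \<in> fin_cofin \<Longrightarrow> - A \<in> fin_cofin"
  by (auto simp: fin_cofin_def)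

lemma fin_cofin_Un: "A \<in> fin_cofin \<Longrightarrow> B \<in> fin_cofin \<Longrightarrow> A \<union> B \<in> fin_cofin"
  by (auto simp: fin_cofin_def)

lemma set_algebra_power_algebra: "set_algebra power_algebra"
  unfolding set_algebra_def
proof (intro conjI ballI)
  show "{} \<in> power_algebra"
    by (simp add: power_algebra_def fin_cofin_def)
  fix a :: "(nat \<times> 'a) set" assume a: "a \<in> power_algebra"
  have "{t. (n, t) \<in> - a} = - {t. (n, t) \<in> a}" for n
    by auto
  then show "- a \<in> power_algebra"
    using a by (simp add: power_algebra_def fin_cofin_Compl)
  fix b :: "(nat \<times> 'a) set" assume b: "b \<in> power_algebra"
  have "{t. (n, t) \<in> a \<union> b} = {t. (n, t) \<in> a} \<union> {t. (n, t) \<in> b}" for n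
    by auto
  then show "a \<union> b \<in> power_algebra"
    using a b by (simp add: power_algebra_def fin_cofin_Un)
qed

text \<open>The section at \<open>n\<close> of a set glued from a sequence is the section at
  \<open>n\<close> of its \<open>n\<close>-th member, so membership is decided one layer at a
  time.\<close>

lemma layered_power_algebra: "layered_algebra power_algebra fst"
  by (auto simp: layered_algebra_def set_algebra_power_algebra) (auto simp: power_algebra_def)

lemma layered_Pow_omega: "layered_algebra (UNIV :: nat set set) id"
  by (simp add: layered_algebra_def set_algebra_def)

lemma card_power_algebra: "|power_algebra :: (nat \<times> nat set) set set| \<le>o continuum"
proof -
  \<comment> \<open>Decoding of a sequence \<open>v\<close>. The entry \<open>v (2 * n)\<close> is a
    control word: its member 0 says whether section \<open>n\<close> is the listed set or its
    complement, and \<open>Suc i\<close> says that the list for \<open>n\<close> uses index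
    \<open>i\<close>. The odd entries hold the listed points. Only surjectivity onto the power
    algebra is required of this code.\<close>
  define F where "F v n = (\<lambda>i. v (Suc (2 * prod_encode (n, i)))) ` {i. Suc i \<in> v (2 * n)}"
    for v :: "nat \<Rightarrow> nat set" and n
  define a where "a v = {(n, t). (t \<in> F v n) = (0 \<in> v (2 * n))}" for v
  have "power_algebra \<subseteq> range a"
  proof
    fix b :: "(nat \<times> nat set) set" assume b: "b \<in> power_algebra"
    have "\<exists>k f s. \<forall>t. (n, t) \<in> b \<longleftrightarrow> (t \<in> f ` {i :: nat. i < k}) = s" for n
    proof -
      obtain A where A: "finite A" "{t. (n, t) \<in> b} = A \<or> {t. (n, t) \<in> b} = - A"
        using b unfolding power_algebra_def fin_cofin_def by (metis (mono_tags, lifting) double_complement mem_Collect_eq)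
      obtain k f where "A = f ` {i :: nat. i < k}"
        using A(1) unfolding finite_conv_nat_seg_image by blast
      then show ?thesis
        using A(2)
        by (intro exI[of _ k] exI[of _ f] exI[of _ "{t. (n, t) \<in> b} = A"]) auto
    qed
    then obtain k f s where kfs: "\<And>n t. (n, t) \<in> b \<longleftrightarrow> (t \<in> f n ` {i :: nat. i < k n}) = s n"
      by metis
    define v where "v m = (if even m then {i. (i = 0 \<and> s (m div 2)) \<or> (\<exists>j. i = Suc j \<and> j < k (m div 2))}
      else (case prod_decode (m div 2) of (n, i) \<Rightarrow> f n i))" for m
    have "F v n = f n ` {i. i < k n}" for n
      by (simp add: F_def v_def)
    then have "b = a v"
      using kfs by (auto simp: a_def v_def)
    then show "b \<in> range a"
      by blast
  qed
  then show ?thesis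
    by (rule card_le_continuumI) (rule card_nat_fun_le[of id], simp)
qed

section \<open>The coordinatewise action and its transport to clopen sets\<close>

definition act :: "('a \<Rightarrow> 'a) \<Rightarrow> (nat \<times> 'a) set \<Rightarrow> (nat \<times> 'a) set" where
  "act \<pi> a = map_prod id \<pi> ` a"

lemma act_Un: "act \<pi> (a \<union> b) = act \<pi> a \<union> act \<pi> b"
  by (simp add: act_def image_Un)

lemma act_Compl: "bij \<pi> \<Longrightarrow> act \<pi> (- a) = - act \<pi> a"
  unfolding act_def by (intro bij_image_Compl_eq bij_betw_map_prod[of id UNIV UNIV \<pi> UNIV UNIV, simplified])

lemma act_comp: "act (\<pi> \<circ> \<rho>) a = act \<pi> (act \<rho> a)"
  unfolding act_def image_image by (rule image_cong) auto

lemma act_id: "act id a = a"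
  by (simp add: act_def map_prod.id)

lemma negligible_act: "negligible_wrt fst (act \<pi> a) \<longleftrightarrow> negligible_wrt fst a"
  by (simp add: negligible_wrt_def act_def image_image)

lemma act_power_algebra:
  assumes \<pi>: "bij \<pi>" and a: "a \<in> power_algebra"
  shows "act \<pi> a \<in> power_algebra"
proof -
  have "{t. (n, t) \<in> act \<pi> a} = \<pi> ` {t. (n, t) \<in> a}" for n
    by (force simp: act_def)
  moreover have "\<pi> ` A \<in> fin_cofin" if "A \<in> fin_cofin" for A
    using that bij_image_Compl_eq[OF \<pi>, of A] unfolding fin_cofin_def
    by (metis (mono_tags, lifting) finite_imageI mem_Collect_eq)
  ultimately show ?thesis
    using a by (simp add: power_algebra_def)
qed

lemma star_subset_iff: "star A \<subseteq> star B \<longleftrightarrow> finite (A - B)"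
proof -
  have "star (A - B) = star A - star B"
    using star_Un[of "- A" B] star_Compl[of "- A \<union> B"] star_Compl[of A] star_subset[of A]
    by (auto simp: Diff_eq)
  then show ?thesis
    using star_empty_iff[of "A - B"] by auto
qed

text \<open>Parovicenko's theorem identifies \<open>P(\<omega>)/fin\<close>, the algebra of clopen subsets of \<open>\<omega>\<^sup>*\<close>, with
  the reduced power.\<close>

lemma clopen_representation:
  assumes CH
  obtains C :: "(nat \<times> nat set) set \<Rightarrow> ((nat \<Rightarrow> real) \<Rightarrow> real) set"
  where "C ` power_algebra = clopen_sets omega_star"
    "\<And>a. a \<in> power_algebra \<Longrightarrow> C (- a) = topspace omega_star - C a"
    "\<And>a b. a \<in> power_algebra \<Longrightarrow> b \<in> power_algebra \<Longrightarrow> C (a \<union> b) = C a \<union> C b"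
    "\<And>a b. a \<in> power_algebra \<Longrightarrow> b \<in> power_algebra \<Longrightarrow> C a \<subseteq> C b \<longleftrightarrow> negligible_wrt fst (a - b)"
proof -
  have "|UNIV :: nat set set| \<le>o continuum"
    by (rule ordIso_imp_ordLeq[OF ordIso_symmetric[OF continuum_ordIso]])
  then obtain R :: "(nat set \<times> (nat \<times> nat set) set) set"
    where R: "partial_iso UNIV id power_algebra fst R" and dom: "fst ` R = UNIV" and ran: "snd ` R = power_algebra"
    by (rule layered_algebras_isomorphic[OF assms layered_Pow_omega layered_power_algebra _ card_power_algebra])
  \<comment> \<open>A member of the power algebra may be related to many subsets of omega, but by
    \<open>sub\<close> these have the same trace, so the choice does not affect
    \<open>C b\<close>.\<close>
  define C where "C b = star (SOME A. (A, b) \<in> R)" for b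
  have sub: "star A \<subseteq> star B \<longleftrightarrow> negligible_wrt fst (a - b)" if "(A, a) \<in> R" "(B, b) \<in> R" for A B a b
    using partial_isoD(5)[OF R partial_iso_Diff[OF R that]] by (simp add: star_subset_iff negligible_wrt_def)
  have C: "C b = star A" if "(A, b) \<in> R" for A b
  proof -
    have "(SOME A. (A, b) \<in> R, b) \<in> R"
      by (rule someI[of "\<lambda>A. (A, b) \<in> R", OF that])
    then show ?thesis
      unfolding C_def using that sub[of _ b _ b] by (intro equalityI) simp_all
  qed
  have ex: "\<exists>A. (A, b) \<in> R" if "b \<in> power_algebra" for b
    using that unfolding ran[symmetric] by force
  show ?thesis
  proof
    show "C ` power_algebra = clopen_sets omega_star"
    proof
      show "C ` power_algebra \<subseteq> clopen_sets omega_star"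
        using star_clopen by (auto simp: C_def)
      show "clopen_sets omega_star \<subseteq> C ` power_algebra"
      proof
        fix U assume "U \<in> clopen_sets omega_star"
        then obtain A where A: "U = star A"
          unfolding clopen_omega_star by blast
        have "A \<in> fst ` R"
          by (simp add: dom)
        then obtain b where b: "(A, b) \<in> R"
          by force
        then have "b \<in> power_algebra"
          unfolding ran[symmetric] by force
        then show "U \<in> C ` power_algebra"
          using C[OF b] A by blast
      qed
    qed
    fix a :: "(nat \<times> nat set) set" assume "a \<in> power_algebra"
    then obtain A where A: "(A, a) \<in> R"
      using ex by blast
    show "C (- a) = topspace omega_star - C a"
      using C[OF A] C[OF partial_isoD(3)[OF R A]] by (simp add: star_Compl)
    fix b :: "(nat \<times> nat set) set" assume "b \<in> power_algebra"
    then obtain B where B: "(B, b) \<in> R"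
      using ex by blast
    show "C (a \<union> b) = C a \<union> C b"
      using C[OF A] C[OF B] C[OF partial_isoD(4)[OF R A B]] by (simp add: star_Un)
    show "C a \<subseteq> C b \<longleftrightarrow> negligible_wrt fst (a - b)"
      using C[OF A] C[OF B] sub[OF A B] by simp
  qed
qed

text \<open>The last two conclusions express compatibility of the topologies: the stabilizer of a
  clopen set contains the pointwise stabilizer of a countable set, and the stabilizer of a point
  contains that of some clopen set.\<close>

theorem symmetric_group_action:
  assumes CH
  obtains \<Psi> :: "(nat set \<Rightarrow> nat set) \<Rightarrow> ((nat \<Rightarrow> real) \<Rightarrow> real) \<Rightarrow> ((nat \<Rightarrow> real) \<Rightarrow> real)"
  where "\<And>\<pi>. bij \<pi> \<Longrightarrow> \<Psi> \<pi> \<in> carrier (homeo_group omega_star)"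
    "\<And>\<pi> \<rho>. bij \<pi> \<Longrightarrow> bij \<rho> \<Longrightarrow> \<Psi> (\<pi> \<circ> \<rho>) = \<Psi> \<pi> \<otimes>\<^bsub>homeo_group omega_star\<^esub> \<Psi> \<rho>"
    "\<And>U. U \<in> clopen_sets omega_star \<Longrightarrow>
      \<exists>D. countable D \<and> (\<forall>\<pi>. bij \<pi> \<and> (\<forall>t\<in>D. \<pi> t = t) \<longrightarrow> \<Psi> \<pi> ` U = U)"
    "\<And>t. \<exists>U\<in>clopen_sets omega_star. \<forall>\<pi>. bij \<pi> \<and> \<Psi> \<pi> ` U = U \<longrightarrow> \<pi> t = t"
proof -
  note X = boolean_space_omega_star
  let ?H = "homeo_group omega_star"
  obtain C :: "(nat \<times> nat set) set \<Rightarrow> ((nat \<Rightarrow> real) \<Rightarrow> real) set"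
    where onto: "C ` power_algebra = clopen_sets omega_star"
    and Compl: "\<And>a. a \<in> power_algebra \<Longrightarrow> C (- a) = topspace omega_star - C a"
    and Un: "\<And>a b. a \<in> power_algebra \<Longrightarrow> b \<in> power_algebra \<Longrightarrow> C (a \<union> b) = C a \<union> C b"
    and sub: "\<And>a b. a \<in> power_algebra \<Longrightarrow> b \<in> power_algebra \<Longrightarrow> C a \<subseteq> C b \<longleftrightarrow> negligible_wrt fst (a - b)"
    using clopen_representation[OF assms] by metis
  note sa = set_algebra_power_algebra
  \<comment> \<open>The coordinatewise action preserves negligibility, hence the order of the
    quotient; in both directions this makes \<open>\<sigma>\<close> independent of the chosen
    representative.\<close>
  have act_sub: "C (act \<pi> a) \<subseteq> C (act \<pi> b)"
    if "bij \<pi>" "a \<in> power_algebra" "b \<in> power_algebra" "C a \<subseteq> C b" for \<pi> a b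
  proof -
    have "act \<pi> a - act \<pi> b = - act \<pi> (- a \<union> b)"
      using that(1) by (auto simp: act_Un act_Compl)
    also have "\<dots> = act \<pi> (a - b)"
      using that(1) by (simp add: act_Compl[symmetric] Diff_eq)
    finally have "negligible_wrt fst (act \<pi> a - act \<pi> b)"
      using sub[OF that(2,3)] that(4) by (simp add: negligible_act)
    then show ?thesis
      using sub[OF act_power_algebra[OF that(1,2)] act_power_algebra[OF that(1,3)]] by simp
  qed
  define \<sigma> where "\<sigma> \<pi> U = C (act \<pi> (SOME a. a \<in> power_algebra \<and> C a = U))" for \<pi> U
  have \<sigma>: "\<sigma> \<pi> (C a) = C (act \<pi> a)" if \<pi>: "bij \<pi>" and a: "a \<in> power_algebra" for \<pi> a
  proof -
    let ?b = "SOME b. b \<in> power_algebra \<and> C b = C a"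
    have "?b \<in> power_algebra \<and> C ?b = C a"
      by (rule someI[of "\<lambda>b. b \<in> power_algebra \<and> C b = C a" a]) (simp add: a)
    then show ?thesis
      unfolding \<sigma>_def using act_sub[OF \<pi> a, of ?b] act_sub[OF \<pi> _ a, of ?b] by (intro equalityI) simp_all
  qed
  have rep: "\<exists>a\<in>power_algebra. U = C a" if "U \<in> clopen_sets omega_star" for U
    using that unfolding onto[symmetric] by blast
  have hom: "clopen_hom omega_star (\<sigma> \<pi>)" if \<pi>: "bij \<pi>" for \<pi>
    unfolding clopen_hom_def
  proof (intro conjI ballI funcsetI)
    fix U assume "U \<in> clopen_sets omega_star"
    then obtain a where a: "a \<in> power_algebra" "U = C a"
      using rep by blast
    show "\<sigma> \<pi> U \<in> clopen_sets omega_star"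
      unfolding onto[symmetric] using a \<sigma>[OF \<pi> a(1)] act_power_algebra[OF \<pi> a(1)] by blast
    show "\<sigma> \<pi> (topspace omega_star - U) = topspace omega_star - \<sigma> \<pi> U"
      using \<sigma>[OF \<pi> set_algebra_Compl[OF sa a(1)]]
      by (simp add: a(2) Compl[OF a(1)] act_Compl[OF \<pi>] Compl[OF act_power_algebra[OF \<pi> a(1)]] \<sigma>[OF \<pi> a(1)])
    fix V assume "V \<in> clopen_sets omega_star"
    then obtain b where b: "b \<in> power_algebra" "V = C b"
      using rep by blast
    show "\<sigma> \<pi> (U \<union> V) = \<sigma> \<pi> U \<union> \<sigma> \<pi> V"
      using \<sigma>[OF \<pi> set_algebra_Un[OF sa a(1) b(1)]] Un[OF a(1) b(1)]
        Un[OF act_power_algebra[OF \<pi> a(1)] act_power_algebra[OF \<pi> b(1)]]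
      by (simp add: a(2) b(2) act_Un \<sigma>[OF \<pi> a(1)] \<sigma>[OF \<pi> b(1)])
  qed
  have inv: "\<sigma> \<pi> (\<sigma> \<rho> U) = U" if "bij \<pi>" "bij \<rho>" "\<pi> \<circ> \<rho> = id" and U: "U \<in> clopen_sets omega_star" for \<pi> \<rho> U
  proof -
    obtain a where a: "a \<in> power_algebra" "U = C a"
      using rep[OF U] by blast
    then show ?thesis
      using \<sigma>[OF that(1) act_power_algebra[OF that(2) a(1)]] \<sigma>[OF that(2) a(1)]
      by (simp add: act_comp[symmetric] that(3) act_id)
  qed
  have "\<exists>h. h \<in> carrier ?H \<and> (\<forall>U\<in>clopen_sets omega_star. h ` U = \<sigma> \<pi> U)" if \<pi>: "bij \<pi>" for \<pi>
  proof -
    have i: "bij (Hilbert_Choice.inv \<pi>)" "\<pi> \<circ> Hilbert_Choice.inv \<pi> = id" "Hilbert_Choice.inv \<pi> \<circ> \<pi> = id"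
      using bij_imp_bij_inv[OF \<pi>] bij_is_surj[OF \<pi>] bij_is_inj[OF \<pi>]
      by (simp_all only: surj_iff inj_iff)
    obtain h where "h \<in> carrier ?H" "\<And>U. U \<in> clopen_sets omega_star \<Longrightarrow> h ` U = \<sigma> \<pi> U"
      by (rule clopen_automorphism_homeomorphism[OF X hom[OF \<pi>] hom[OF i(1)] inv[OF i(1) \<pi> i(3)] inv[OF \<pi> i(1,2)]])
        (assumption | rule that | simp)+
    then show ?thesis
      by blast
  qed
  then obtain \<Psi> where \<Psi>: "\<And>\<pi>. bij \<pi> \<Longrightarrow> \<Psi> \<pi> \<in> carrier ?H"
    "\<And>\<pi> U. bij \<pi> \<Longrightarrow> U \<in> clopen_sets omega_star \<Longrightarrow> \<Psi> \<pi> ` U = \<sigma> \<pi> U"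
    by metis
  have \<Psi>C: "\<Psi> \<pi> ` C a = C (act \<pi> a)" if "bij \<pi>" "a \<in> power_algebra" for \<pi> a
  proof -
    have "C a \<in> clopen_sets omega_star"
      using that(2) onto by blast
    then show ?thesis
      using \<Psi>(2)[OF that(1)] \<sigma>[OF that] by simp
  qed
  show ?thesis
  proof
    show "\<Psi> \<pi> \<in> carrier ?H" if "bij \<pi>" for \<pi>
      by (rule \<Psi>(1)[OF that])
    show "\<Psi> (\<pi> \<circ> \<rho>) = \<Psi> \<pi> \<otimes>\<^bsub>?H\<^esub> \<Psi> \<rho>" if \<pi>: "bij \<pi>" and \<rho>: "bij \<rho>" for \<pi> \<rho>
    proof (rule homeo_group_eqI[OF X])
      show "\<Psi> (\<pi> \<circ> \<rho>) \<in> carrier ?H"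
        by (intro \<Psi>(1) bij_comp \<pi> \<rho>)
      show "\<Psi> \<pi> \<otimes>\<^bsub>?H\<^esub> \<Psi> \<rho> \<in> carrier ?H"
        by (intro monoid.m_closed[OF group.is_monoid[OF group_homeo_group]] \<Psi>(1) \<pi> \<rho>)
      fix U assume U: "U \<in> clopen_sets omega_star"
      then obtain a where a: "a \<in> power_algebra" "U = C a"
        using rep by blast
      have "\<Psi> (\<pi> \<circ> \<rho>) ` U = \<Psi> \<pi> ` \<Psi> \<rho> ` U"
        unfolding a(2) \<Psi>C[OF bij_comp[OF \<rho> \<pi>] a(1)] \<Psi>C[OF \<rho> a(1)] \<Psi>C[OF \<pi> act_power_algebra[OF \<rho> a(1)]]
        by (simp add: act_comp)
      then show "\<Psi> (\<pi> \<circ> \<rho>) ` U = (\<Psi> \<pi> \<otimes>\<^bsub>?H\<^esub> \<Psi> \<rho>) ` U"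
        by (simp add: homeo_group_mult_image[OF \<Psi>(1)[OF \<pi>] \<Psi>(1)[OF \<rho>] clopen_sets_subset[OF U]])
    qed
    show "\<exists>D. countable D \<and> (\<forall>\<pi>. bij \<pi> \<and> (\<forall>t\<in>D. \<pi> t = t) \<longrightarrow> \<Psi> \<pi> ` U = U)"
      if U: "U \<in> clopen_sets omega_star" for U
    proof -
      obtain a where a: "a \<in> power_algebra" "U = C a"
        using rep[OF U] by blast
      \<comment> \<open>A finite support of the section at \<open>n\<close>: the section or its
        complement, whichever is finite. A permutation fixing it pointwise preserves the
        section.\<close>
      define E where "E n = (if finite {t. (n, t) \<in> a} then {t. (n, t) \<in> a} else - {t. (n, t) \<in> a})" for n
      have "finite (E n)" for n
        using a(1) by (auto simp: E_def power_algebra_def fin_cofin_def)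
      then have "countable (\<Union>n. E n)"
        by (intro countable_UN) (auto intro: countable_finite)
      moreover have "\<Psi> \<pi> ` U = U" if \<pi>: "bij \<pi>" and fixed: "\<forall>t\<in>(\<Union>n. E n). \<pi> t = t" for \<pi>
      proof -
        have iff: "(n, \<pi> t) \<in> a \<longleftrightarrow> (n, t) \<in> a" for n t
        proof -
          have "\<pi> t \<in> E n \<longleftrightarrow> t \<in> E n"
            using fixed bij_is_inj[OF \<pi>] by (metis UN_I UNIV_I injD)
          then show ?thesis
            by (auto simp: E_def split: if_splits)
        qed
        have "act \<pi> a = a"
        proof
          show "act \<pi> a \<subseteq> a"
            using iff by (auto simp: act_def)
          show "a \<subseteq> act \<pi> a"
          proof safe
            fix n t assume "(n, t) \<in> a"
            moreover obtain t' where "t = \<pi> t'"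
              using bij_is_surj[OF \<pi>] by blast
            ultimately show "(n, t) \<in> act \<pi> a"
              using iff unfolding act_def by (intro image_eqI[of _ _ "(n, t')"]) auto
          qed
        qed
        then show ?thesis
          using \<Psi>C[OF \<pi> a(1)] a(2) by simp
      qed
      ultimately show ?thesis
        by blast
    qed
    show "\<exists>U\<in>clopen_sets omega_star. \<forall>\<pi>. bij \<pi> \<and> \<Psi> \<pi> ` U = U \<longrightarrow> \<pi> t = t" for t
    proof -
      \<comment> \<open>Constant sequences at singletons detect points: for
        \<open>\<pi> t \<noteq> t\<close> the sequences at \<open>t\<close> and
        \<open>\<pi> t\<close> differ in every layer, so their clopen sets differ too.\<close>
      have t: "UNIV \<times> {s} \<in> power_algebra" for s :: "nat set"
        by (simp add: power_algebra_def fin_cofin_def)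
      have "\<pi> t = t" if \<pi>: "bij \<pi>" and eq: "\<Psi> \<pi> ` C (UNIV \<times> {t}) = C (UNIV \<times> {t})" for \<pi>
      proof (rule ccontr)
        assume ne: "\<pi> t \<noteq> t"
        have "act \<pi> (UNIV \<times> {t}) = UNIV \<times> {\<pi> t}"
          by (auto simp: act_def map_prod_def image_iff)
        then have "C (UNIV \<times> {\<pi> t}) \<subseteq> C (UNIV \<times> {t})"
          using \<Psi>C[OF \<pi> t[of t]] eq by simp
        then have "negligible_wrt fst (UNIV \<times> {\<pi> t} - UNIV \<times> {t})"
          using sub[OF t t] by simp
        moreover have "UNIV \<times> {\<pi> t} - UNIV \<times> {t} = (UNIV :: nat set) \<times> {\<pi> t}"
          using ne by auto
        ultimately show False
          by (simp add: negligible_wrt_def)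
      qed
      then show ?thesis
        using t[of t] onto by (intro bexI[of _ "C (UNIV \<times> {t})"]) auto
    qed
  qed
qed

section \<open>Groups with a P-space topology\<close>

lemma topological_groupD:
  assumes "topological_group G X"
  shows "group G" "topspace X = carrier G" "t1_space X"
    "continuous_map (prod_topology X X) X (\<lambda>(x, y). x \<otimes>\<^bsub>G\<^esub> y)"
    "continuous_map X X (\<lambda>x. inv\<^bsub>G\<^esub> x)"
  using assms by (auto simp: topological_group_def tychonoff_space_def)

lemma continuous_map_mult_left:
  assumes G: "topological_group G X" and a: "a \<in> carrier G"
  shows "continuous_map X X (\<lambda>x. a \<otimes>\<^bsub>G\<^esub> x)"
proof -
  have "continuous_map X (prod_topology X X) (\<lambda>x. (a, x))"
    using a topological_groupD(2)[OF G] by (simp add: continuous_map_pairedI)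
  from continuous_map_compose[OF this topological_groupD(4)[OF G]] show ?thesis
    by (simp add: o_def)
qed

lemma continuous_map_mult_right:
  assumes G: "topological_group G X" and a: "a \<in> carrier G"
  shows "continuous_map X X (\<lambda>x. x \<otimes>\<^bsub>G\<^esub> a)"
proof -
  have "continuous_map X (prod_topology X X) (\<lambda>x. (x, a))"
    using a topological_groupD(2)[OF G] by (simp add: continuous_map_pairedI)
  from continuous_map_compose[OF this topological_groupD(4)[OF G]] show ?thesis
    by (simp add: o_def)
qed

lemma openin_mult_left_preimage:
  assumes G: "topological_group G X" and "a \<in> carrier G" "openin X U"
  shows "openin X {x \<in> carrier G. a \<otimes>\<^bsub>G\<^esub> x \<in> U}"
  using openin_continuous_map_preimage[OF continuous_map_mult_left[OF assms(1,2)] assms(3)]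
  by (simp add: topological_groupD(2)[OF G])

lemma openin_mult_right_preimage:
  assumes G: "topological_group G X" and "a \<in> carrier G" "openin X U"
  shows "openin X {x \<in> carrier G. x \<otimes>\<^bsub>G\<^esub> a \<in> U}"
  using openin_continuous_map_preimage[OF continuous_map_mult_right[OF assms(1,2)] assms(3)]
  by (simp add: topological_groupD(2)[OF G])

section \<open>Open subgroups and coset actions of P-groups\<close>

lemma P_space_countable_Inter:
  assumes "P_space X" "countable \<U>" "\<U> \<noteq> {}" "\<And>U. U \<in> \<U> \<Longrightarrow> openin X U"
  shows "openin X (\<Inter>\<U>)"
  using assms gdelta_in_Inter[of \<U> X] open_imp_gdelta_in unfolding P_space_def by blast

lemma topological_group_small_nbhd:
  fixes G (structure)
  assumes G: "topological_group G X" and U: "openin X U" "\<one>\<^bsub>G\<^esub> \<in> U"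
  obtains W where "openin X W" "\<one>\<^bsub>G\<^esub> \<in> W" "W \<subseteq> U"
    "\<And>x y. x \<in> W \<Longrightarrow> y \<in> W \<Longrightarrow> x \<otimes>\<^bsub>G\<^esub> inv\<^bsub>G\<^esub> y \<in> U"
proof -
  interpret group G
    by (rule topological_groupD(1)[OF G])
  have top: "topspace X = carrier G"
    by (rule topological_groupD(2)[OF G])
  have snd: "continuous_map (prod_topology X X) X (\<lambda>p. inv (snd p))"
    using continuous_map_compose[OF continuous_map_snd topological_groupD(5)[OF G]] by (simp add: o_def)
  have "continuous_map (prod_topology X X) (prod_topology X X) (\<lambda>p. (fst p, inv (snd p)))"
    by (intro continuous_map_pairedI continuous_map_fst snd)
  from continuous_map_compose[OF this topological_groupD(4)[OF G]]
  have "continuous_map (prod_topology X X) X (\<lambda>p. fst p \<otimes> inv (snd p))"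
    by (simp add: o_def)
  from openin_continuous_map_preimage[OF this U(1)]
  have "openin (prod_topology X X) {p \<in> carrier G \<times> carrier G. fst p \<otimes> inv (snd p) \<in> U}"
    by (simp add: top)
  moreover have "(\<one>, \<one>) \<in> {p \<in> carrier G \<times> carrier G. fst p \<otimes> inv (snd p) \<in> U}"
    using U(2) by simp
  ultimately obtain A B where AB: "openin X A" "openin X B" "\<one> \<in> A" "\<one> \<in> B"
    "A \<times> B \<subseteq> {p \<in> carrier G \<times> carrier G. fst p \<otimes> inv (snd p) \<in> U}"
    unfolding openin_prod_topology_alt by meson
  have AB': "x \<otimes> inv y \<in> U" if "x \<in> A" "y \<in> B" for x y
    using AB(5) that by auto
  show ?thesis
  proof (rule that[of "A \<inter> B"])
    show "openin X (A \<inter> B)"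
      by (intro openin_Int AB(1,2))
    show "A \<inter> B \<subseteq> U"
    proof
      fix x assume x: "x \<in> A \<inter> B"
      then have "x \<in> carrier G"
        using openin_subset[OF AB(1)] top by blast
      then show "x \<in> U"
        using AB'[of x \<one>] x AB(4) by simp
    qed
  qed (use AB AB' in auto)
qed

text \<open>In a P-group the intersection of a sequence \<open>W\<^sub>n\<close> with \<open>W\<^sub>n\<^sub>+\<^sub>1 W\<^sub>n\<^sub>+\<^sub>1\<^sup>-\<^sup>1 \<subseteq> W\<^sub>n\<close> is an
  open subgroup.\<close>

lemma P_group_open_subgroup:
  fixes G (structure)
  assumes G: "P_group G X" and U: "openin X U" "\<one>\<^bsub>G\<^esub> \<in> U"
  obtains K where "subgroup K G" "openin X K" "K \<subseteq> U"
proof -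
  have tg: "topological_group G X" and P: "P_space X"
    using G by (auto simp: P_group_def)
  interpret group G
    by (rule topological_groupD(1)[OF tg])
  have "\<exists>W. \<forall>n. (openin X (W n) \<and> \<one> \<in> W n \<and> W n \<subseteq> U) \<and>
      (\<forall>x\<in>W (Suc n). \<forall>y\<in>W (Suc n). x \<otimes> inv y \<in> W n)"
  proof (rule dependent_nat_choice)
    show "\<exists>W. openin X W \<and> \<one> \<in> W \<and> W \<subseteq> U"
      using U by blast
    fix W and n :: nat assume W: "openin X W \<and> \<one> \<in> W \<and> W \<subseteq> U"
    then obtain V where V: "openin X V" "\<one> \<in> V" "V \<subseteq> W" "\<And>x y. x \<in> V \<Longrightarrow> y \<in> V \<Longrightarrow> x \<otimes> inv y \<in> W"
      using topological_group_small_nbhd[OF tg, of W] by blast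
    then show "\<exists>V. (openin X V \<and> \<one> \<in> V \<and> V \<subseteq> U) \<and> (\<forall>x\<in>V. \<forall>y\<in>V. x \<otimes> inv y \<in> W)"
      using W by (intro exI[of _ V]) auto
  qed
  then obtain W where W': "\<forall>n. (openin X (W n) \<and> \<one> \<in> W n \<and> W n \<subseteq> U) \<and>
      (\<forall>x\<in>W (Suc n). \<forall>y\<in>W (Suc n). x \<otimes> inv y \<in> W n)" ..
  then have W: "\<And>n. openin X (W n)" "\<And>n. \<one> \<in> W n" "\<And>n. W n \<subseteq> U"
    "\<And>n x y. x \<in> W (Suc n) \<Longrightarrow> y \<in> W (Suc n) \<Longrightarrow> x \<otimes> inv y \<in> W n"
    by simp_all
  define K where "K = (\<Inter>n. W n)"
  have KG: "K \<subseteq> carrier G"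
    using openin_subset[OF W(1)[of 0]] topological_groupD(2)[OF tg] by (auto simp: K_def)
  have div: "x \<otimes> inv y \<in> K" if "x \<in> K" "y \<in> K" for x y
    unfolding K_def
  proof
    fix n
    show "x \<otimes> inv y \<in> W n"
      using that by (intro W(4)) (auto simp: K_def)
  qed
  have one: "\<one> \<in> K"
    using W(2) by (auto simp: K_def)
  have inv: "inv y \<in> K" if "y \<in> K" for y
    using div[OF one that] that KG by auto
  have "subgroup K G"
  proof (rule subgroupI[OF KG])
    show "K \<noteq> {}"
      using one by blast
    fix x y assume xy: "x \<in> K" "y \<in> K"
    show "inv x \<in> K"
      by (rule inv[OF xy(1)])
    show "x \<otimes> y \<in> K"
      using div[OF xy(1) inv[OF xy(2)]] xy(2) KG by auto
  qed
  moreover have "openin X K"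
    unfolding K_def by (rule P_space_countable_Inter[OF P]) (use W(1) in auto)
  moreover have "K \<subseteq> U"
    using W(3)[of 0] by (auto simp: K_def)
  ultimately show ?thesis
    by (rule that)
qed

text \<open>The action by left multiplication on all cosets of sufficiently many open subgroups.\<close>

lemma P_group_action:
  fixes G :: "'a monoid" (structure)
  assumes G: "P_group G X" and w: "weight X \<le>o continuum"
  shows "\<exists>\<rho> :: 'a \<Rightarrow> nat set \<Rightarrow> nat set.
    (\<forall>g\<in>carrier G. bij (\<rho> g)) \<and>
    (\<forall>g\<in>carrier G. \<forall>h\<in>carrier G. \<rho> (g \<otimes>\<^bsub>G\<^esub> h) = \<rho> g \<circ> \<rho> h) \<and>
    (\<forall>t. openin X {g \<in> carrier G. \<rho> g t = t}) \<and>
    (\<forall>U. openin X U \<longrightarrow> \<one>\<^bsub>G\<^esub> \<in> U \<longrightarrow> (\<exists>t. {g \<in> carrier G. \<rho> g t = t} \<subseteq> U))"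
proof -
  have tg: "topological_group G X"
    using G by (auto simp: P_group_def)
  interpret group G
    by (rule topological_groupD(1)[OF tg])
  have top: "topspace X = carrier G"
    by (rule topological_groupD(2)[OF tg])
  obtain \<B> where \<B>: "base_of X \<B>" and wB: "weight X = |\<B>|"
    using weight_minimal_base(1) by blast
  have "|\<B>| \<le>o |UNIV :: nat set set|"
    using ordLeq_ordIso_trans[OF w continuum_ordIso] by (simp add: wB)
  then obtain j :: "'a set \<Rightarrow> nat set" where j: "inj_on j \<B>"
    unfolding card_of_ordLeq[symmetric] by blast
  define \<N> where "\<N> = {V \<in> \<B>. \<one> \<in> V}"
  have "\<exists>K. subgroup K G \<and> openin X K \<and> K \<subseteq> V" if "V \<in> \<N>" for V
  proof -
    have "openin X V" "\<one> \<in> V"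
      using that \<B> by (auto simp: \<N>_def base_of_def)
    then show ?thesis
      using P_group_open_subgroup[OF G] by metis
  qed
  then obtain K where K: "\<And>V. V \<in> \<N> \<Longrightarrow> subgroup (K V) G" "\<And>V. V \<in> \<N> \<Longrightarrow> openin X (K V)"
    "\<And>V. V \<in> \<N> \<Longrightarrow> K V \<subseteq> V"
    by metis
  have KG: "K V \<subseteq> carrier G" if "V \<in> \<N>" for V
    by (rule subgroup.subset[OF K(1)[OF that]])
  \<comment> \<open>One open subgroup per basic neighbourhood of the identity, so that the coset of
    some single point has a stabilizer inside any given neighbourhood.\<close>
  define S where "S = {a <# K V | a V. a \<in> carrier G \<and> V \<in> \<N>}"
  have self: "a \<in> a <# K V" if "a \<in> carrier G" "V \<in> \<N>" for a V
    using that subgroup.one_closed[OF K(1)[OF that(2)]] by (force simp: l_coset_def)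
  have same: "a <# K V = b <# K V"
    if "a \<in> carrier G" "b \<in> carrier G" "V \<in> \<N>" "x \<in> a <# K V" "x \<in> b <# K V" for a b x V
    using l_repr_independence[OF that(4,1) K(1)[OF that(3)]] l_repr_independence[OF that(5,2) K(1)[OF that(3)]]
    by simp
  have open_coset: "openin X (a <# K V)" if a: "a \<in> carrier G" and V: "V \<in> \<N>" for a V
  proof -
    have "a <# K V = {x \<in> carrier G. inv a \<otimes> x \<in> K V}"
    proof (intro equalityI subsetI)
      fix x assume "x \<in> a <# K V"
      then obtain k where k: "k \<in> K V" "x = a \<otimes> k"
        by (auto simp: l_coset_def)
      then have "k \<in> carrier G"
        using KG[OF V] by blast
      then show "x \<in> {x \<in> carrier G. inv a \<otimes> x \<in> K V}"
        using k a by (simp add: m_assoc[symmetric])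
    next
      fix x assume "x \<in> {x \<in> carrier G. inv a \<otimes> x \<in> K V}"
      then show "x \<in> a <# K V"
        using a by (intro subgroup.lcos_module_rev[OF K(1)[OF V]]) (auto simp: is_group)
    qed
    then show ?thesis
      using openin_mult_left_preimage[OF tg inv_closed[OF a] K(2)[OF V]] by simp
  qed
  \<comment> \<open>Counting cosets: distinct cosets of one subgroup are disjoint, so a coset is
    determined by the index of its subgroup and one nonempty basic set inside it. A base of size at
    most the continuum therefore bounds their number.\<close>
  have "\<exists>V W. V \<in> \<N> \<and> W \<in> \<B> \<and> W \<noteq> {} \<and> W \<subseteq> s \<and> (\<exists>a\<in>carrier G. s = a <# K V)" if s: "s \<in> S" for s
  proof -
    obtain a V where aV: "s = a <# K V" "a \<in> carrier G" "V \<in> \<N>"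
      using s by (auto simp: S_def)
    then obtain W where "W \<in> \<B>" "a \<in> W" "W \<subseteq> s"
      using \<B> open_coset self unfolding base_of_def by metis
    then show ?thesis
      using aV by blast
  qed
  then obtain v w where vw: "\<And>s. s \<in> S \<Longrightarrow> v s \<in> \<N>" "\<And>s. s \<in> S \<Longrightarrow> w s \<in> \<B>" "\<And>s. s \<in> S \<Longrightarrow> w s \<noteq> {}"
    "\<And>s. s \<in> S \<Longrightarrow> w s \<subseteq> s" "\<And>s. s \<in> S \<Longrightarrow> \<exists>a\<in>carrier G. s = a <# K (v s)"
    by metis
  \<comment> \<open>The two codes are interleaved at the even and odd positions of one set of
    integers.\<close>
  define \<iota> where "\<iota> s = {n. if even n then n div 2 \<in> j (v s) else n div 2 \<in> j (w s)}" for s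
  have \<iota>: "inj_on \<iota> S"
  proof (rule inj_onI)
    fix s s' assume s: "s \<in> S" "s' \<in> S" and eq: "\<iota> s = \<iota> s'"
    have "n \<in> j (v s) \<longleftrightarrow> n \<in> j (v s')" "n \<in> j (w s) \<longleftrightarrow> n \<in> j (w s')" for n
      using eq[THEN eqset_imp_iff, of "2 * n"] eq[THEN eqset_imp_iff, of "Suc (2 * n)"]
      by (simp_all add: \<iota>_def)
    then have "j (v s) = j (v s')" "j (w s) = j (w s')"
      by blast+
    then have eqs: "v s = v s'" "w s = w s'"
      using j vw(1,2) s by (auto simp: \<N>_def dest: inj_onD)
    obtain x where x: "x \<in> w s"
      using vw(3)[OF s(1)] by blast
    obtain a b where "a \<in> carrier G" "s = a <# K (v s)" "b \<in> carrier G" "s' = b <# K (v s)"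
      using vw(5)[OF s(1)] vw(5)[OF s(2)] eqs by metis
    moreover have "x \<in> s" "x \<in> s'"
      using x vw(4)[OF s(1)] vw(4)[OF s(2)] eqs by auto
    ultimately show "s = s'"
      using same[OF _ _ vw(1)[OF s(1)]] by metis
  qed
  have SG: "s \<subseteq> carrier G" if "s \<in> S" for s
    using that KG by (auto simp: S_def l_coset_def)
  have trans: "g <# s \<in> S" if g: "g \<in> carrier G" and s: "s \<in> S" for g s
  proof -
    obtain a V where aV: "s = a <# K V" "a \<in> carrier G" "V \<in> \<N>"
      using s by (auto simp: S_def)
    then have "g <# s = (g \<otimes> a) <# K V"
      by (simp add: lcos_m_assoc[OF KG[OF aV(3)] g aV(2)])
    then show ?thesis
      unfolding S_def using m_closed[OF g aV(2)] aV(3) by blast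
  qed
  \<comment> \<open>Sets that code no coset are left fixed, which extends the action on
    \<open>S\<close> to permutations of the whole type.\<close>
  define \<rho> where "\<rho> g t = (if t \<in> \<iota> ` S then \<iota> (g <# inv_into S \<iota> t) else t)" for g t
  have \<rho>\<iota>: "\<rho> g (\<iota> s) = \<iota> (g <# s)" if "s \<in> S" for g s
    using that \<iota> by (simp add: \<rho>_def)
  have \<rho>_off: "\<rho> g t = t" if "t \<notin> \<iota> ` S" for g t
    using that by (simp add: \<rho>_def)
  have mult: "\<rho> (g \<otimes> h) = \<rho> g \<circ> \<rho> h" if g: "g \<in> carrier G" and h: "h \<in> carrier G" for g h
  proof
    fix t
    show "\<rho> (g \<otimes> h) t = (\<rho> g \<circ> \<rho> h) t"
    proof (cases "t \<in> \<iota> ` S")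
      case True
      then obtain s where s: "s \<in> S" "t = \<iota> s"
        by blast
      then show ?thesis
        using g h by (simp add: \<rho>\<iota> trans lcos_m_assoc[OF SG])
    qed (simp add: \<rho>_off)
  qed
  have one: "\<rho> \<one> = id"
  proof
    fix t
    show "\<rho> \<one> t = id t"
      using \<rho>\<iota>[of _ \<one>] \<rho>_off[of t \<one>] lcos_mult_one[OF SG] by (cases "t \<in> \<iota> ` S") auto
  qed
  have bij: "bij (\<rho> g)" if g: "g \<in> carrier G" for g
    by (rule o_bij[of "\<rho> (inv g)"]) (simp_all add: mult[symmetric] g one)
  \<comment> \<open>The stabilizer of a coset of \<open>K V\<close> is the conjugate of
    \<open>K V\<close> by \<open>a\<close>. In this form it is the preimage of an open coset under
    right translation, hence open; for \<open>a = \<one>\<close> it is \<open>K V\<close>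
    itself.\<close>
  have fix_iff: "\<rho> g (\<iota> (a <# K V)) = \<iota> (a <# K V) \<longleftrightarrow> g \<otimes> a \<in> a <# K V"
    if g: "g \<in> carrier G" and a: "a \<in> carrier G" and V: "V \<in> \<N>" for g a V
  proof -
    have aS: "a <# K V \<in> S"
      using a V by (auto simp: S_def)
    have "\<rho> g (\<iota> (a <# K V)) = \<iota> (a <# K V) \<longleftrightarrow> g <# (a <# K V) = a <# K V"
      using \<rho>\<iota>[OF aS] inj_on_eq_iff[OF \<iota> trans[OF g aS] aS] by simp
    also have "\<dots> \<longleftrightarrow> (g \<otimes> a) <# K V = a <# K V"
      by (simp add: lcos_m_assoc[OF KG[OF V] g a])
    also have "\<dots> \<longleftrightarrow> g \<otimes> a \<in> a <# K V"
      using self[OF m_closed[OF g a] V] l_repr_independence[OF _ a K(1)[OF V], of "g \<otimes> a"] by auto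
    finally show ?thesis .
  qed
  have stab: "openin X {g \<in> carrier G. \<rho> g t = t}" for t
  proof (cases "t \<in> \<iota> ` S")
    case True
    then obtain a V where aV: "t = \<iota> (a <# K V)" "a \<in> carrier G" "V \<in> \<N>"
      by (auto simp: S_def)
    have "{g \<in> carrier G. \<rho> g t = t} = {g \<in> carrier G. g \<otimes> a \<in> a <# K V}"
      using fix_iff aV by blast
    then show ?thesis
      using openin_mult_right_preimage[OF tg aV(2) open_coset[OF aV(2,3)]] by simp
  next
    case False
    then have "{g \<in> carrier G. \<rho> g t = t} = topspace X"
      by (simp add: \<rho>_off top)
    then show ?thesis
      by simp
  qed
  have small: "\<exists>t. {g \<in> carrier G. \<rho> g t = t} \<subseteq> U" if U: "openin X U" "\<one> \<in> U" for U
  proof -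
    obtain V where V: "V \<in> \<B>" "\<one> \<in> V" "V \<subseteq> U"
      using \<B> U unfolding base_of_def by blast
    then have VN: "V \<in> \<N>"
      by (simp add: \<N>_def)
    have "g \<in> U" if g: "g \<in> carrier G" "\<rho> g (\<iota> (\<one> <# K V)) = \<iota> (\<one> <# K V)" for g
      using fix_iff[OF g(1) one_closed VN] g K(3)[OF VN] V(3) by (auto simp: lcos_mult_one[OF KG[OF VN]])
    then show ?thesis
      by blast
  qed
  show ?thesis
    by (intro exI[of _ \<rho>] conjI ballI allI impI bij mult stab small)
qed

text \<open>The coset action is composed with the action of the symmetric group. Continuity:
  countably many clopen sets involve countably many points altogether, and the intersection of their
  open stabilizers is open because \<open>X\<close> is a P-space. Openness onto the image: a
  neighbourhood in \<open>G\<close> contains a translate of the stabilizer of a single point, and a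
  single clopen set detects that point.\<close>

lemma P_group_embeds:
  fixes G :: "'a monoid"
  assumes CH and G: "P_group G X" and w: "weight X \<le>o continuum"
  shows "isomorphic_to_subgroup G X (homeo_group omega_star) (homeo_delta omega_star)"
proof -
  note X = boolean_space_omega_star
  let ?H = "homeo_group omega_star" and ?Y = "homeo_delta omega_star"
  obtain \<Psi> :: "(nat set \<Rightarrow> nat set) \<Rightarrow> ((nat \<Rightarrow> real) \<Rightarrow> real) \<Rightarrow> ((nat \<Rightarrow> real) \<Rightarrow> real)"
    where \<Psi>: "\<And>\<pi>. bij \<pi> \<Longrightarrow> \<Psi> \<pi> \<in> carrier ?H"
    "\<And>\<pi> \<rho>. bij \<pi> \<Longrightarrow> bij \<rho> \<Longrightarrow> \<Psi> (\<pi> \<circ> \<rho>) = \<Psi> \<pi> \<otimes>\<^bsub>?H\<^esub> \<Psi> \<rho>"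
    "\<And>U. U \<in> clopen_sets omega_star \<Longrightarrow>
      \<exists>D. countable D \<and> (\<forall>\<pi>. bij \<pi> \<and> (\<forall>t\<in>D. \<pi> t = t) \<longrightarrow> \<Psi> \<pi> ` U = U)"
    "\<And>t. \<exists>U\<in>clopen_sets omega_star. \<forall>\<pi>. bij \<pi> \<and> \<Psi> \<pi> ` U = U \<longrightarrow> \<pi> t = t"
    by (rule symmetric_group_action[OF \<open>CH\<close>]) (rule that; simp)
  obtain \<rho> :: "'a \<Rightarrow> nat set \<Rightarrow> nat set"
    where \<rho>': "(\<forall>g\<in>carrier G. bij (\<rho> g)) \<and>
      (\<forall>g\<in>carrier G. \<forall>h\<in>carrier G. \<rho> (g \<otimes>\<^bsub>G\<^esub> h) = \<rho> g \<circ> \<rho> h) \<and>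
      (\<forall>t. openin X {g \<in> carrier G. \<rho> g t = t}) \<and>
      (\<forall>U. openin X U \<longrightarrow> \<one>\<^bsub>G\<^esub> \<in> U \<longrightarrow> (\<exists>t. {g \<in> carrier G. \<rho> g t = t} \<subseteq> U))"
    using P_group_action[OF G w] ..
  then have \<rho>: "\<And>g. g \<in> carrier G \<Longrightarrow> bij (\<rho> g)"
    "\<And>g h. g \<in> carrier G \<Longrightarrow> h \<in> carrier G \<Longrightarrow> \<rho> (g \<otimes>\<^bsub>G\<^esub> h) = \<rho> g \<circ> \<rho> h"
    "\<And>t. openin X {g \<in> carrier G. \<rho> g t = t}"
    "\<And>U. openin X U \<Longrightarrow> \<one>\<^bsub>G\<^esub> \<in> U \<Longrightarrow> \<exists>t. {g \<in> carrier G. \<rho> g t = t} \<subseteq> U"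
    by simp_all
  have tg: "topological_group G X" and P: "P_space X"
    using G by (auto simp: P_group_def)
  interpret G: group G
    by (rule topological_groupD(1)[OF tg])
  interpret H: group ?H
    by (rule group_homeo_group)
  have top: "topspace X = carrier G"
    by (rule topological_groupD(2)[OF tg])
  define h where "h g = \<Psi> (\<rho> g)" for g
  define L where "L = h ` carrier G"
  have hH: "h g \<in> carrier ?H" if "g \<in> carrier G" for g
    unfolding h_def by (intro \<Psi>(1) \<rho>(1) that)
  have hm: "h (g \<otimes>\<^bsub>G\<^esub> k) = h g \<otimes>\<^bsub>?H\<^esub> h k" if "g \<in> carrier G" "k \<in> carrier G" for g k
    unfolding h_def \<rho>(2)[OF that] by (intro \<Psi>(2) \<rho>(1) that)
  have hom: "h \<in> hom G ?H"
    using hH hm by (simp add: hom_def)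
  have sub: "subgroup L ?H"
    unfolding L_def using group_hom.img_is_subgroup[of G ?H h] hom
    by (simp add: group_hom_def group_hom_axioms_def G.is_group H.is_group)
  \<comment> \<open>Agreement of two images is reduced to invariance under the quotient of the two
    elements, the form in which \<open>\<Psi>\<close> is controlled.\<close>
  have diff: "(h g ` U = h k ` U) \<longleftrightarrow> h (inv\<^bsub>G\<^esub> g \<otimes>\<^bsub>G\<^esub> k) ` U = U"
    if g: "g \<in> carrier G" and k: "k \<in> carrier G" and U: "U \<in> clopen_sets omega_star" for g k U
  proof -
    have gk: "inv\<^bsub>G\<^esub> g \<otimes>\<^bsub>G\<^esub> k \<in> carrier G"
      using g k by simp
    have UT: "U \<subseteq> topspace omega_star"
      by (rule clopen_sets_subset[OF U])
    have "h k = h g \<otimes>\<^bsub>?H\<^esub> h (inv\<^bsub>G\<^esub> g \<otimes>\<^bsub>G\<^esub> k)"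
      using hm[OF g gk] g k by (simp add: G.m_assoc[symmetric])
    then have "h k ` U = h g ` h (inv\<^bsub>G\<^esub> g \<otimes>\<^bsub>G\<^esub> k) ` U"
      using homeo_group_mult_image[OF hH[OF g] hH[OF gk] UT] by simp
    then show ?thesis
      using homeo_group_image_inject[OF hH[OF g] UT homeo_group_image_subset[OF hH[OF gk] UT]] by auto
  qed
  have nbhd: "\<exists>U\<in>clopen_sets omega_star. \<forall>k\<in>carrier G. h k ` U = h g ` U \<longrightarrow> k \<in> W"
    if g: "g \<in> carrier G" and W: "openin X W" "g \<in> W" for g W
  proof -
    have "openin X {x \<in> carrier G. g \<otimes>\<^bsub>G\<^esub> x \<in> W}"
      by (rule openin_mult_left_preimage[OF tg g W(1)])
    moreover have "\<one>\<^bsub>G\<^esub> \<in> {x \<in> carrier G. g \<otimes>\<^bsub>G\<^esub> x \<in> W}"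
      using g W(2) by simp
    ultimately obtain t where t: "{x \<in> carrier G. \<rho> x t = t} \<subseteq> {x \<in> carrier G. g \<otimes>\<^bsub>G\<^esub> x \<in> W}"
      using \<rho>(4) by blast
    obtain U where U: "U \<in> clopen_sets omega_star" "\<And>\<pi>. bij \<pi> \<Longrightarrow> \<Psi> \<pi> ` U = U \<Longrightarrow> \<pi> t = t"
      using \<Psi>(4)[of t] by blast
    have "k \<in> W" if k: "k \<in> carrier G" and eq: "h k ` U = h g ` U" for k
    proof -
      let ?x = "inv\<^bsub>G\<^esub> g \<otimes>\<^bsub>G\<^esub> k"
      have x: "?x \<in> carrier G"
        using g k by simp
      have "\<Psi> (\<rho> ?x) ` U = U"
        using diff[OF g k U(1)] eq by (simp add: h_def)
      then have "\<rho> ?x t = t"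
        by (rule U(2)[OF \<rho>(1)[OF x]])
      then have "g \<otimes>\<^bsub>G\<^esub> ?x \<in> W"
        using t x by blast
      then show ?thesis
        using g k by (simp add: G.m_assoc[symmetric])
    qed
    then show ?thesis
      using U(1) by blast
  qed
  \<comment> \<open>Injectivity comes from the same neighbourhoods: a T1 neighbourhood of
    \<open>g\<close> excluding \<open>k\<close> gives a clopen set with different images.\<close>
  have inj: "inj_on h (carrier G)"
  proof (rule inj_onI, rule ccontr)
    fix g k assume gk: "g \<in> carrier G" "k \<in> carrier G" "h g = h k" "g \<noteq> k"
    then obtain W where "openin X W" "g \<in> W" "k \<notin> W"
      using topological_groupD(3)[OF tg] unfolding t1_space_def top by metis
    then show False
      using nbhd[OF gk(1), of W] gk(2,3) by auto
  qed
  have topL: "topspace (subtopology ?Y L) = L"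
    using sub subgroup.subset[OF sub] by (auto simp: topspace_homeo_delta[OF X])
  have "continuous_map X (subtopology ?Y L) h"
  proof (rule continuous_map_into_subtopology)
    show "h \<in> topspace X \<rightarrow> L"
      by (auto simp: top L_def)
    show "continuous_map X ?Y h"
      unfolding continuous_map_def
    proof (intro conjI allI impI)
      show "h \<in> topspace X \<rightarrow> topspace ?Y"
        using hH by (auto simp: top topspace_homeo_delta[OF X])
      fix W assume W: "openin ?Y W"
      show "openin X {x \<in> topspace X. h x \<in> W}"
      proof (subst openin_subopen, intro ballI)
        fix g assume "g \<in> {x \<in> topspace X. h x \<in> W}"
        then have g: "g \<in> carrier G" "h g \<in> W"
          by (auto simp: top)
        obtain \<C> where \<C>: "countable \<C>" "\<C> \<subseteq> clopen_sets omega_star" "agreeing omega_star (h g) \<C> \<subseteq> W"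
          by (rule homeo_deltaD[OF X W g(2)])
        have "\<forall>U\<in>\<C>. \<exists>D. countable D \<and> (\<forall>\<pi>. bij \<pi> \<and> (\<forall>t\<in>D. \<pi> t = t) \<longrightarrow> \<Psi> \<pi> ` U = U)"
          by (intro ballI \<Psi>(3) subsetD[OF \<C>(2)])
        from bchoice[OF this] obtain d
          where d': "\<forall>U\<in>\<C>. countable (d U) \<and> (\<forall>\<pi>. bij \<pi> \<and> (\<forall>t\<in>d U. \<pi> t = t) \<longrightarrow> \<Psi> \<pi> ` U = U)" ..
        then have d: "\<And>U. U \<in> \<C> \<Longrightarrow> countable (d U)"
          "\<And>U \<pi>. U \<in> \<C> \<Longrightarrow> bij \<pi> \<Longrightarrow> \<forall>t\<in>d U. \<pi> t = t \<Longrightarrow> \<Psi> \<pi> ` U = U"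
          by simp_all
        define D where "D = (\<Union>U\<in>\<C>. d U)"
        have "countable D"
          unfolding D_def by (intro countable_UN \<C>(1) d(1))
        \<comment> \<open>The inserted carrier keeps the intersection inside the group, and the
          family nonempty, when \<open>D\<close> is empty.\<close>
        define V where "V = \<Inter>(insert (carrier G) ((\<lambda>t. {x \<in> carrier G. \<rho> x t = t}) ` D))"
        have "openin X V"
          unfolding V_def using \<open>countable D\<close> \<rho>(3) openin_topspace[of X]
          by (intro P_space_countable_Inter[OF P]) (auto simp: top)
        then have "openin X {x \<in> carrier G. inv\<^bsub>G\<^esub> g \<otimes>\<^bsub>G\<^esub> x \<in> V}"
          by (rule openin_mult_left_preimage[OF tg G.inv_closed[OF g(1)]])
        moreover have "\<rho> \<one>\<^bsub>G\<^esub> = id"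
        proof -
          have "\<rho> \<one>\<^bsub>G\<^esub> (\<rho> \<one>\<^bsub>G\<^esub> t) = \<rho> \<one>\<^bsub>G\<^esub> t" for t
            using \<rho>(2)[OF G.one_closed G.one_closed] by (metis G.one_closed G.r_one comp_apply)
          then have "\<rho> \<one>\<^bsub>G\<^esub> t = t" for t
            by (rule injD[OF bij_is_inj[OF \<rho>(1)[OF G.one_closed]]])
          then show ?thesis
            by (intro ext) simp
        qed
        then have "g \<in> {x \<in> carrier G. inv\<^bsub>G\<^esub> g \<otimes>\<^bsub>G\<^esub> x \<in> V}"
          using g(1) by (simp add: V_def)
        moreover have "h k \<in> W" if k: "k \<in> carrier G" "inv\<^bsub>G\<^esub> g \<otimes>\<^bsub>G\<^esub> k \<in> V" for k
        proof -
          let ?x = "inv\<^bsub>G\<^esub> g \<otimes>\<^bsub>G\<^esub> k"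
          have x: "?x \<in> carrier G"
            using g(1) k(1) by simp
          have "h k ` U = h g ` U" if U: "U \<in> \<C>" for U
          proof -
            have "\<forall>t\<in>d U. \<rho> ?x t = t"
              using k(2) U by (auto simp: V_def D_def)
            then have "h ?x ` U = U"
              unfolding h_def by (rule d(2)[OF U \<rho>(1)[OF x]])
            moreover have "U \<in> clopen_sets omega_star"
              using U \<C>(2) by blast
            ultimately have "h g ` U = h k ` U"
              using diff[OF g(1) k(1)] by simp
            then show ?thesis
              by (rule sym)
          qed
          then have "h k \<in> agreeing omega_star (h g) \<C>"
            using hH[OF k(1)] by (simp add: agreeing_def)
          then show ?thesis
            using \<C>(3) by blast
        qed
        ultimately show "\<exists>T. openin X T \<and> g \<in> T \<and> T \<subseteq> {x \<in> topspace X. h x \<in> W}"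
          by (intro exI[of _ "{x \<in> carrier G. inv\<^bsub>G\<^esub> g \<otimes>\<^bsub>G\<^esub> x \<in> V}"]) (auto simp: top)
      qed
    qed
  qed
  moreover have "open_map X (subtopology ?Y L) h"
    unfolding open_map_def
  proof (intro allI impI)
    fix W assume W: "openin X W"
    then have WG: "W \<subseteq> carrier G"
      using openin_subset top by blast
    show "openin (subtopology ?Y L) (h ` W)"
    proof (subst openin_subopen, intro ballI)
      fix y assume "y \<in> h ` W"
      then obtain g where g: "g \<in> W" "y = h g"
        by blast
      then have gG: "g \<in> carrier G"
        using WG by blast
      obtain U where U: "U \<in> clopen_sets omega_star" "\<And>k. k \<in> carrier G \<Longrightarrow> h k ` U = h g ` U \<Longrightarrow> k \<in> W"
        using nbhd[OF gG W g(1)] by blast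
      have "openin (subtopology ?Y L) (agreeing omega_star y {U} \<inter> L)"
        using U(1) by (intro openin_subtopology_Int openin_agreeing[OF X]) auto
      moreover have "y \<in> agreeing omega_star y {U} \<inter> L"
        using g(2) gG hH[OF gG] by (auto simp: agreeing_def L_def)
      moreover have "agreeing omega_star y {U} \<inter> L \<subseteq> h ` W"
      proof
        fix z assume z: "z \<in> agreeing omega_star y {U} \<inter> L"
        then obtain k where k: "k \<in> carrier G" "z = h k"
          by (auto simp: L_def)
        then have "h k ` U = h g ` U"
          using z g(2) by (simp add: agreeing_def)
        then show "z \<in> h ` W"
          using U(2)[OF k(1)] k(2) by blast
      qed
      ultimately show "\<exists>T. openin (subtopology ?Y L) T \<and> y \<in> T \<and> T \<subseteq> h ` W"
        by blast
    qed
  qed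
  ultimately have "homeomorphic_map X (subtopology ?Y L) h"
    using inj by (intro bijective_open_imp_homeomorphic_map) (simp_all only: top topL L_def[symmetric])
  moreover have "h \<in> iso G (?H\<lparr>carrier := L\<rparr>)"
    using hm inj by (auto simp: iso_def hom_def bij_betw_def L_def)
  ultimately show ?thesis
    unfolding isomorphic_to_subgroup_def topological_isomorphism_def using sub by blast
qed

theorem theorem1p2:
  assumes CH
  shows "P_group (homeo_group omega_star) (Gdelta_modification (compact_open_topology omega_star)) \<and>
    weight (Gdelta_modification (compact_open_topology omega_star)) \<le>o continuum \<and>
    (\<forall>(G :: 'a monoid) (X :: 'a topology).
       P_group G X \<and> weight X \<le>o continuum \<longrightarrow>
       isomorphic_to_subgroup G X
         (homeo_group omega_star) (Gdelta_modification (compact_open_topology omega_star)))"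
  using P_group_homeo_delta[OF boolean_space_omega_star] weight_homeo_delta_omega_star P_group_embeds[OF assms]
  by blast

end
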